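(* Let $\phi\colon\mathbb{D}\to\mathbb{D}$ be an analytic self-map. There exists $w\in H^2$, $w\not\equiv0$, such that the weighted composition operator $M_wC_\phi\colon f\mapsto w\,(f\circ\phi)$ is a (bounded) Hilbert–Schmidt operator on $H^2$ if and only if $$\int_{\mathbb{T}}\log\Big(\frac{1}{1-|\phi^\ast|}\Big)\,dm<+\infty .$$
   Context: $\mathbb{D}$ is the open unit disk, $\mathbb{T}=\partial\mathbb{D}$, $m$ the normalized Lebesgue measure on $\mathbb{T}$, $H^2$ the Hardy space. $\phi^\ast(\xi)=\lim_{r\to1^-}\phi(r\xi)$ is the radial limit function of $\phi$, defined $m$-a.e.; the integrand is taken to be $+\infty$ where $|\phi^\ast|=1$. *)

theory Defs
  imports "HOL-Analysis.Analysis"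
begin

definition taylor_coeff :: "(complex \<Rightarrow> complex) \<Rightarrow> nat \<Rightarrow> complex" where
  "taylor_coeff f n = (deriv ^^ n) f 0 / of_nat (fact n)"

definition hardy2 :: "(complex \<Rightarrow> complex) \<Rightarrow> bool" where
  "hardy2 f \<longleftrightarrow> f holomorphic_on ball 0 1 \<and> summable (\<lambda>n. (cmod (taylor_coeff f n))^2)"

definition h2norm :: "(complex \<Rightarrow> complex) \<Rightarrow> real" where
  "h2norm f = sqrt (\<Sum>n. (cmod (taylor_coeff f n))^2)"

text \<open>M_w C_phi is a bounded Hilbert-Schmidt operator on H^2 (w.r.t. the orthonormal basis z^n).\<close>
definition wcomp_HS :: "(complex \<Rightarrow> complex) \<Rightarrow> (complex \<Rightarrow> complex) \<Rightarrow> bool" where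
  "wcomp_HS w \<phi> \<longleftrightarrow>
     (\<forall>f. hardy2 f \<longrightarrow> hardy2 (\<lambda>z. w z * f (\<phi> z))) \<and>
     (\<exists>C. \<forall>f. hardy2 f \<longrightarrow> h2norm (\<lambda>z. w z * f (\<phi> z)) \<le> C * h2norm f) \<and>
     summable (\<lambda>n. (h2norm (\<lambda>z. w z * (\<phi> z) ^ n))^2)"

definition radial_limit :: "(complex \<Rightarrow> complex) \<Rightarrow> real \<Rightarrow> complex" where
  "radial_limit \<phi> t = Lim (at_left 1) (\<lambda>r::real. \<phi> (complex_of_real r * cis t))"

definition has_radial_limit :: "(complex \<Rightarrow> complex) \<Rightarrow> real \<Rightarrow> bool" where
  "has_radial_limit \<phi> t \<longleftrightarrow> (\<exists>L. ((\<lambda>r::real. \<phi> (complex_of_real r * cis t)) \<longlongrightarrow> L) (at_left 1))"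

text \<open>Integrand log(1/(1-|phi^*|)), taken to be +infinity where |phi^*| = 1 (or where the
  radial limit fails to exist, a null set).\<close>
definition log_integrand :: "(complex \<Rightarrow> complex) \<Rightarrow> real \<Rightarrow> ennreal" where
  "log_integrand \<phi> t =
     (if has_radial_limit \<phi> t \<and> cmod (radial_limit \<phi> t) < 1
      then ennreal (ln (1 / (1 - cmod (radial_limit \<phi> t)))) else \<infinity>)"

definition circle_log_integral :: "(complex \<Rightarrow> complex) \<Rightarrow> ennreal" where
  "circle_log_integral \<phi> = (\<integral>\<^sup>+ t\<in>{0..2*pi}. log_integrand \<phi> t \<partial>lborel) / ennreal (2*pi)"

end

theory Submission
  imports Defs "HOL-Complex_Analysis.Complex_Analysis"
begin

text \<open>
  Summing \<open>\<parallel>w \<phi>\<^sup>n\<parallel>\<^sup>2\<close> over \<open>n\<close> shows that the Hilbert--Schmidt condition bounds the means of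
  \<open>\<bar>w\<bar>\<^sup>2 / (1 - \<bar>\<phi>\<bar>\<^sup>2)\<close> over the circles of radius \<open>r < 1\<close>. If it holds, Szego's inequality
  \<open>\<bar>h 0\<bar>\<^sup>2 exp (mean u) \<le> mean (\<bar>h\<bar>\<^sup>2 exp u)\<close> with \<open>u = -ln (1 - \<bar>\<phi>\<bar>\<^sup>2)\<close> and \<open>h = w / z\<^sup>k\<close> bounds the
  means of \<open>u\<close>, and Fatou's lemma moves the bound to the boundary. Conversely, let \<open>w\<close> be the outer
  function with \<open>\<bar>w\<bar>\<^sup>2 = 1 - \<bar>\<phi>\<bar>\<close> on the circle. As \<open>-ln (1 - \<bar>\<phi>\<bar>)\<close> is subharmonic, it lies below
  the Poisson integral of its boundary values, hence \<open>\<bar>w\<bar>\<^sup>2 \<le> 1 - \<bar>\<phi>\<bar>\<close> in the disc.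
  That radial limits exist almost everywhere follows from the weak-type estimate for the radial
  maximal function, which rests on Vitali's covering lemma.
\<close>

section \<open>Circle means and the Poisson formula\<close>

text \<open>Estimates are made on circles of radius r < 1, where everything is continuous, with
  constants that do not depend on r; Parseval carries them to and from the Taylor coefficients in
  \<open>hardy2\<close>. Szego's inequality is evaluated at 0 and is void if w vanishes there. This
  is why w is divided by z^k, with k the order of its zero at 0. The division costs a factor
  r^(-2k), so radii are kept above 1/2. The weight is modelled on 1 - |phi|, whose logarithm is the
  integrand of the theorem, while the Hilbert--Schmidt sum produces 1 - |phi|^2; the quotient 1 +
  |phi| lies between 1 and 2 and costs at most ln 2. A bound |w|^2 \<le> 1 - |phi|^2 on the whole
  disc does more than make the sum finite: it balances the growth of point evaluations on H^2, so w
  (f o phi) is a bounded function for each f in H^2. The integrand is not known to be Borel at the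
  outset; it is replaced almost everywhere by a limit along a sequence of radii.\<close>

definition mean_sq :: "(complex \<Rightarrow> complex) \<Rightarrow> real \<Rightarrow> real" where
  "mean_sq f r = integral {0..2*pi} (\<lambda>t. (cmod (f (of_real r * cis t)))\<^sup>2) / (2*pi)"

lemma has_integral_cis_multiple:
  "((\<lambda>t. cis (of_int n * t)) has_integral (if n = 0 then of_real (2*pi) else 0)) {0..2*pi}"
proof (cases "n = 0")
  case True
  then show ?thesis
    using has_integral_const_real[of "1::complex" 0 "2*pi"] by (simp add: scaleR_conv_of_real)
next
  case False
  have "((\<lambda>t. cis (of_int n * t)) has_integral
      (cis (of_int n * (2*pi)) / (\<i> * of_int n) - cis (of_int n * 0) / (\<i> * of_int n))) {0..2*pi}"
  proof (rule fundamental_theorem_of_calculus)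
    fix t :: real
    have "((\<lambda>z. exp (\<i> * of_int n * z) / (\<i> * of_int n)) has_field_derivative
           exp (\<i> * of_int n * of_real t)) (at (of_real t))"
      using False by (auto intro!: derivative_eq_intros)
    from has_vector_derivative_real_field[OF this]
    show "((\<lambda>t. cis (of_int n * t) / (\<i> * of_int n)) has_vector_derivative cis (of_int n * t))
           (at t within {0..2*pi})"
      by (simp add: cis_conv_exp algebra_simps)
  qed simp
  moreover have "cis (of_int n * (2*pi)) = 1"
    by (metis cis_multiple_2pi Ints_of_int mult.commute)
  ultimately show ?thesis
    using False by simp
qed

lemma has_integral_norm_trig_polynomial:
  fixes c :: "nat \<Rightarrow> complex"
  shows "((\<lambda>t. (cmod (\<Sum>n<N. c n * cis (real n * t)))\<^sup>2) has_integral
            2 * pi * (\<Sum>n<N. (cmod (c n))\<^sup>2)) {0..2*pi}"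
proof -
  have eq: "complex_of_real ((cmod (\<Sum>n<N. c n * cis (real n * t)))\<^sup>2) =
      (\<Sum>j<N. \<Sum>k<N. c j * cnj (c k) * cis (of_int (int j - int k) * t))" for t
  proof -
    have "cis (of_int (int j - int k) * t) = cis (real j * t) * cnj (cis (real k * t))" for j k
      by (simp add: cis_cnj cis_mult cis_divide left_diff_distrib)
    then show ?thesis
      unfolding complex_norm_square by (simp add: sum_product mult_ac)
  qed
  have "((\<lambda>t. \<Sum>j<N. \<Sum>k<N. c j * cnj (c k) * cis (of_int (int j - int k) * t)) has_integral
      (\<Sum>j<N. \<Sum>k<N. c j * cnj (c k) * (if int j - int k = 0 then of_real (2*pi) else 0))) {0..2*pi}"
    by (intro has_integral_sum has_integral_mult_right has_integral_cis_multiple) auto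
  also have "(\<Sum>j<N. \<Sum>k<N. c j * cnj (c k) * (if int j - int k = 0 then of_real (2*pi) else 0)) =
     (\<Sum>j<N. \<Sum>k<N. if j = k then c j * cnj (c j) * of_real (2*pi) else 0)"
    by (intro sum.cong refl) auto
  also have "\<dots> = (\<Sum>j<N. c j * cnj (c j) * of_real (2*pi))"
    by simp
  also have "\<dots> = of_real (2 * pi * (\<Sum>n<N. (cmod (c n))\<^sup>2))"
    by (simp add: sum_distrib_left complex_norm_square mult_ac flip: of_real_power)
  finally have "((\<lambda>t. complex_of_real ((cmod (\<Sum>n<N. c n * cis (real n * t)))\<^sup>2)) has_integral
     of_real (2 * pi * (\<Sum>n<N. (cmod (c n))\<^sup>2))) {0..2*pi}"
    by (simp only: eq)
  from has_integral_linear[OF this bounded_linear_Re] show ?thesis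
    by (simp add: o_def)
qed

lemma taylor_coeff_sums:
  assumes "f holomorphic_on ball 0 R" "cmod z < R"
  shows "(\<lambda>n. taylor_coeff f n * z ^ n) sums f z"
  using holomorphic_power_series[of f 0 R z] assms by (simp add: taylor_coeff_def)

text \<open>Convergence at a radius s > r makes the series absolutely convergent on the circle of
  radius r, so the square of its absolute sum dominates all partial sums and the finite identity
  passes to the limit. The coefficients are arbitrary so that tails of a Taylor series are covered
  too.\<close>

lemma Parseval_power_series:
  fixes c :: "nat \<Rightarrow> complex"
  assumes f: "\<And>z. cmod z < R \<Longrightarrow> (\<lambda>n. c n * z ^ n) sums f z" and r: "0 \<le> r" "r < R"
  shows "(\<lambda>n. (cmod (c n))\<^sup>2 * r ^ (2*n)) sums mean_sq f r"
proof -
  define B where "B = (\<Sum>n. cmod (c n) * r ^ n)"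
  obtain s where s: "r < s" "s < R" using r dense by blast
  have "summable (\<lambda>n. c n * of_real s ^ n)"
    using f[of "of_real s"] s r by (auto simp: sums_iff)
  then have "summable (\<lambda>n. norm (c n * of_real r ^ n))"
    by (rule powser_insidea) (use s r in auto)
  then have sm: "summable (\<lambda>n. cmod (c n) * r ^ n)"
    using r by (simp add: norm_mult norm_power)
  have *: "(\<lambda>N. integral {0..2*pi} (\<lambda>t. (cmod (\<Sum>n<N. (c n * of_real r ^ n) * cis (real n * t)))\<^sup>2))
     \<longlonglongrightarrow> integral {0..2*pi} (\<lambda>t. (cmod (f (of_real r * cis t)))\<^sup>2)"
  proof (rule dominated_convergence)
    show "(\<lambda>t. (cmod (\<Sum>n<N. (c n * of_real r ^ n) * cis (real n * t)))\<^sup>2) integrable_on {0..2*pi}" for N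
      by (rule has_integral_integrable[OF has_integral_norm_trig_polynomial])
    show "(\<lambda>t. B\<^sup>2) integrable_on {0..2*pi}" by (rule integrable_const_ivl)
    show "norm ((cmod (\<Sum>n<N. (c n * of_real r ^ n) * cis (real n * t)))\<^sup>2) \<le> B\<^sup>2" for N t
    proof -
      have "cmod (\<Sum>n<N. (c n * of_real r ^ n) * cis (real n * t)) \<le> (\<Sum>n<N. cmod (c n) * r ^ n)"
        by (rule order.trans[OF norm_sum]) (use r in \<open>simp add: norm_mult norm_power\<close>)
      also have "\<dots> \<le> B"
        unfolding B_def using r by (intro sum_le_suminf sm) auto
      finally show ?thesis by (simp add: power_mono)
    qed
    show "(\<lambda>N. (cmod (\<Sum>n<N. (c n * of_real r ^ n) * cis (real n * t)))\<^sup>2)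
         \<longlonglongrightarrow> (cmod (f (of_real r * cis t)))\<^sup>2" for t
    proof -
      have "(\<lambda>n. c n * (of_real r * cis t) ^ n) sums f (of_real r * cis t)"
        by (rule f) (use r in \<open>simp add: norm_mult\<close>)
      moreover have "c n * (of_real r * cis t) ^ n = (c n * of_real r ^ n) * cis (real n * t)" for n
        by (simp add: power_mult_distrib Complex.DeMoivre)
      ultimately show ?thesis
        unfolding sums_def by (intro tendsto_intros) simp
    qed
  qed
  have "integral {0..2*pi} (\<lambda>t. (cmod (\<Sum>n<N. (c n * of_real r ^ n) * cis (real n * t)))\<^sup>2) / (2*pi)
      = (\<Sum>n<N. (cmod (c n))\<^sup>2 * r ^ (2*n))" for N
    using integral_unique[OF has_integral_norm_trig_polynomial[where N = N and c = "\<lambda>n. c n * of_real r ^ n"]] r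
    by (simp add: norm_mult norm_power power_mult_distrib power_even_eq)
  with tendsto_divide[OF * tendsto_const, of "2*pi"] show ?thesis
    by (simp add: sums_def mean_sq_def)
qed

lemma Parseval_circle:
  assumes "f holomorphic_on ball 0 R" "0 \<le> r" "r < R"
  shows "(\<lambda>n. (cmod (taylor_coeff f n))\<^sup>2 * r ^ (2*n)) sums mean_sq f r"
  using assms by (intro Parseval_power_series taylor_coeff_sums)

lemma mean_sq_upper:
  assumes "continuous_on (ball 0 1) f" "0 \<le> r" "r < 1" "\<And>z. cmod z < 1 \<Longrightarrow> cmod (f z) \<le> B"
  shows "mean_sq f r \<le> B\<^sup>2"
proof -
  have "integral {0..2*pi} (\<lambda>t. (cmod (f (of_real r * cis t)))\<^sup>2) \<le> integral {0..2*pi} (\<lambda>t. B\<^sup>2)"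
  proof (rule integral_le)
    show "(\<lambda>t. (cmod (f (of_real r * cis t)))\<^sup>2) integrable_on {0..2*pi}"
      by (intro integrable_continuous_interval continuous_intros continuous_on_compose2[OF assms(1)])
         (use assms in \<open>auto simp: norm_mult\<close>)
  qed (use assms in \<open>auto intro!: power_mono simp: norm_mult\<close>)
  then show ?thesis
    by (simp add: mean_sq_def field_simps)
qed

text \<open>This is the term n = 0 of Parseval's series. The disc has radius R because Szego's
  inequality applies it on the unit circle itself.\<close>

lemma norm_at_0_le_mean_sq:
  assumes f: "f holomorphic_on ball 0 R" and r: "0 \<le> r" "r < R"
  shows "(cmod (f 0))\<^sup>2 \<le> mean_sq f r"
proof -
  have s: "(\<lambda>n. (cmod (taylor_coeff f n))\<^sup>2 * r ^ (2*n)) sums mean_sq f r"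
    by (rule Parseval_circle[OF f r])
  have "(\<Sum>n<1. (cmod (taylor_coeff f n))\<^sup>2 * r ^ (2*n)) \<le> mean_sq f r"
    using sum_le_suminf[OF sums_summable[OF s], of "{..<1}"] sums_unique[OF s] r by simp
  then show ?thesis by (simp add: taylor_coeff_def)
qed

section \<open>H^2 norms as limits of circle means\<close>

lemma h2norm_sums:
  assumes "hardy2 f"
  shows "(\<lambda>n. (cmod (taylor_coeff f n))\<^sup>2) sums (h2norm f)\<^sup>2"
  using assms by (auto simp: hardy2_def h2norm_def sums_iff suminf_nonneg)

lemma mean_sq_le_h2norm:
  assumes f: "hardy2 f" and r: "0 \<le> r" "r < 1"
  shows "mean_sq f r \<le> (h2norm f)\<^sup>2"
proof (rule sums_le[OF _ Parseval_circle h2norm_sums[OF f]])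
  show "f holomorphic_on ball 0 1" using f by (simp add: hardy2_def)
  show "(cmod (taylor_coeff f n))\<^sup>2 * r ^ (2*n) \<le> (cmod (taylor_coeff f n))\<^sup>2" for n
    using r by (intro mult_right_le_one_le power_le_one) auto
qed (use r in auto)

text \<open>The double sum is finite, so at radius r it is a polynomial in r and the bound survives
  r -> 1 by continuity. A whole family is treated at once because the Hilbert--Schmidt sum is
  controlled through the sum of the means, not term by term.\<close>

lemma sum_taylor_coeff_le:
  fixes f :: "'i \<Rightarrow> complex \<Rightarrow> complex"
  assumes hol: "\<And>i. i \<in> I \<Longrightarrow> f i holomorphic_on ball 0 1"
    and B: "\<And>r. 0 \<le> r \<Longrightarrow> r < 1 \<Longrightarrow> (\<Sum>i\<in>I. mean_sq (f i) r) \<le> B"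
  shows "(\<Sum>i\<in>I. \<Sum>n<N. (cmod (taylor_coeff (f i) n))\<^sup>2) \<le> B"
proof -
  let ?S = "\<lambda>r. \<Sum>i\<in>I. \<Sum>n<N. (cmod (taylor_coeff (f i) n))\<^sup>2 * r ^ (2*n)"
  have "?S r \<le> B" if "0 \<le> r" "r < 1" for r :: real
  proof -
    have "?S r \<le> (\<Sum>i\<in>I. mean_sq (f i) r)"
    proof (rule sum_mono)
      fix i assume "i \<in> I"
      then have s: "(\<lambda>n. (cmod (taylor_coeff (f i) n))\<^sup>2 * r ^ (2*n)) sums mean_sq (f i) r"
        using Parseval_circle[OF hol] that by blast
      then show "(\<Sum>n<N. (cmod (taylor_coeff (f i) n))\<^sup>2 * r ^ (2*n)) \<le> mean_sq (f i) r"
        using sum_le_suminf[OF sums_summable[OF s], of "{..<N}"] sums_unique[OF s] that by simp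
    qed
    with B[OF that] show ?thesis by linarith
  qed
  then have ev: "eventually (\<lambda>r. ?S r \<le> B) (at_left 1)"
    by (auto simp: eventually_at_left_field intro!: exI[of _ 0])
  have "(?S \<longlongrightarrow> ?S 1) (at_left 1)"
    by (intro tendsto_intros)
  from tendsto_upperbound[OF this ev] have "?S 1 \<le> B"
    by simp
  then show ?thesis by simp
qed

lemma hardy2_if_mean_sq_bounded:
  assumes hol: "f holomorphic_on ball 0 1"
    and B: "\<And>r. 0 \<le> r \<Longrightarrow> r < 1 \<Longrightarrow> mean_sq f r \<le> B"
  shows "hardy2 f"
proof -
  have "(\<Sum>n<N. (cmod (taylor_coeff f n))\<^sup>2) \<le> B" for N
    using sum_taylor_coeff_le[of "{()}" "\<lambda>_. f" B N] hol B by simp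
  then have "summable (\<lambda>n. (cmod (taylor_coeff f n))\<^sup>2)"
    by (intro summableI_nonneg_bounded) auto
  with hol show ?thesis by (simp add: hardy2_def)
qed

lemma sum_h2norm_le:
  fixes f :: "'i \<Rightarrow> complex \<Rightarrow> complex"
  assumes h2: "\<And>i. i \<in> I \<Longrightarrow> hardy2 (f i)"
    and B: "\<And>r. 0 \<le> r \<Longrightarrow> r < 1 \<Longrightarrow> (\<Sum>i\<in>I. mean_sq (f i) r) \<le> B"
  shows "(\<Sum>i\<in>I. (h2norm (f i))\<^sup>2) \<le> B"
proof (rule LIMSEQ_le_const2)
  show "(\<lambda>N. \<Sum>i\<in>I. \<Sum>n<N. (cmod (taylor_coeff (f i) n))\<^sup>2) \<longlonglongrightarrow> (\<Sum>i\<in>I. (h2norm (f i))\<^sup>2)"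
    using h2norm_sums[OF h2] by (intro tendsto_sum) (auto simp: sums_def)
  show "\<exists>N. \<forall>n\<ge>N. (\<Sum>i\<in>I. \<Sum>n<n. (cmod (taylor_coeff (f i) n))\<^sup>2) \<le> B"
    using sum_taylor_coeff_le[of I f B] h2 B by (auto simp: hardy2_def)
qed

lemma hardy2_bounded:
  assumes hol: "f holomorphic_on ball 0 1" and B: "\<And>z. cmod z < 1 \<Longrightarrow> cmod (f z) \<le> B"
  shows "hardy2 f" "h2norm f \<le> B"
proof -
  have m: "mean_sq f r \<le> B\<^sup>2" if "0 \<le> r" "r < 1" for r
    using mean_sq_upper that B hol holomorphic_on_imp_continuous_on by blast
  show h: "hardy2 f"
    using hardy2_if_mean_sq_bounded hol m by blast
  have "(h2norm f)\<^sup>2 \<le> B\<^sup>2"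
    using sum_h2norm_le[of "{()}" "\<lambda>_. f" "B\<^sup>2"] h m by simp
  moreover have "0 \<le> B" using B[of 0] norm_ge_zero[of "f 0"] by (metis norm_zero order.trans zero_less_one)
  ultimately show "h2norm f \<le> B" by (rule power2_le_imp_le)
qed

section \<open>The Poisson kernel\<close>

definition poisson_kernel :: "complex \<Rightarrow> real \<Rightarrow> real" where
  "poisson_kernel a t = (1 - (cmod a)\<^sup>2) / (cmod (cis t - a))\<^sup>2"

lemma poisson_kernel_nonneg: "cmod a < 1 \<Longrightarrow> 0 \<le> poisson_kernel a t"
  by (simp add: poisson_kernel_def power_le_one)

lemma cis_neq_of_norm_less_1: "cmod a < 1 \<Longrightarrow> cis t \<noteq> a"
  by auto

lemma continuous_on_poisson_kernel:
  "cmod a < 1 \<Longrightarrow> continuous_on S (poisson_kernel a)"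
  unfolding poisson_kernel_def
  by (intro continuous_intros) (auto simp: cis_neq_of_norm_less_1)

text \<open>Cauchy's formula for \<open>f z (1 - \<bar>a\<bar>\<^sup>2) / (1 - cnj a z)\<close>, a function that agrees with \<open>f\<close> at \<open>a\<close>.\<close>
lemma Poisson_formula:
  assumes f: "f holomorphic_on ball 0 R" "1 < R" and a: "cmod a < 1"
  shows "((\<lambda>t. of_real (poisson_kernel a t) * f (cis t)) has_integral of_real (2*pi) * f a) {0..2*pi}"
proof -
  define h where "h z = f z * of_real (1 - (cmod a)\<^sup>2) / (1 - cnj a * z)" for z
  have nz: "1 - cnj a * z \<noteq> 0" if "cmod z \<le> 1" for z
  proof
    assume "1 - cnj a * z = 0"
    then have "cmod (cnj a * z) = 1" by simp
    then have "cmod a * cmod z = 1" by (simp add: norm_mult)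
    moreover have "cmod a * cmod z \<le> cmod a * 1" using that by (intro mult_left_mono) auto
    ultimately show False using a by linarith
  qed
  have "h holomorphic_on cball 0 1"
    unfolding h_def using nz f by (intro holomorphic_intros holomorphic_on_subset[OF f(1)]) auto
  from Cauchy_integral_circlepath_simple[OF this, of a] a
  have "((\<lambda>u. h u / (u - a)) has_contour_integral (2 * of_real pi * \<i> * h a)) (circlepath 0 1)"
    by simp
  then have "((\<lambda>t. h (cis t) / (cis t - a) * (\<i> * cis t)) has_integral (2 * of_real pi * \<i> * h a)) {0..2*pi}"
    unfolding circlepath_def by (subst (asm) has_contour_integral_part_circlepath_iff) (auto simp: mult_ac)
  then have "((\<lambda>t. (h (cis t) / (cis t - a) * (\<i> * cis t)) / \<i>) has_integral (2 * of_real pi * \<i> * h a) / \<i>) {0..2*pi}"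
    by (rule has_integral_divide)
  moreover have "(h (cis t) / (cis t - a) * (\<i> * cis t)) / \<i> = of_real (poisson_kernel a t) * f (cis t)" for t
  proof -
    have "of_real ((cmod (cis t - a))\<^sup>2) = (cis t - a) * (cnj (cis t) - cnj a)"
      by (simp add: complex_norm_square del: of_real_power)
    \<comment> \<open>Conjugation is inversion on the circle, so the squared distance becomes a
      rational function of \<open>cis t\<close> and matches the Cauchy integrand.\<close>
    moreover have "cnj (cis t) - cnj a = (1 - cnj a * cis t) / cis t"
      by (simp add: field_simps cis_cnj cis_mult)
    ultimately have "complex_of_real (poisson_kernel a t) =
        of_real (1 - (cmod a)\<^sup>2) / ((cis t - a) * ((1 - cnj a * cis t) / cis t))"
      unfolding poisson_kernel_def of_real_divide by simp
    moreover have "(h (cis t) / (cis t - a) * (\<i> * cis t)) / \<i> = h (cis t) / (cis t - a) * cis t"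
      by (metis complex_i_not_zero mult.left_commute nonzero_mult_div_cancel_left)
    ultimately show ?thesis
      by (simp add: h_def mult_ac)
  qed
  moreover have "h a = f a"
  proof -
    have "complex_of_real (1 - (cmod a)\<^sup>2) = 1 - cnj a * a"
      using complex_norm_square[of a] by (simp add: mult.commute)
    then show ?thesis using nz[of a] a unfolding h_def by simp
  qed
  moreover have "(2 * of_real pi * \<i> * h a) / \<i> = of_real (2*pi) * h a"
    by (simp add: field_simps)
  ultimately show ?thesis by (simp only:)
qed

section \<open>Radial limits almost everywhere\<close>

text \<open>An even kernel that decreases away from 0 is a superposition of centred intervals. This
  is realised by integration by parts: with \<open>F s\<close> the integral of f over the interval
  of radius s, the product \<open>K s * (F s - 2 * s * c)\<close> vanishes at 0 and is nonpositive
  at pi, and the part of its derivative containing \<open>K' s\<close> is nonnegative.\<close>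

lemma decreasing_kernel_average:
  fixes f K K' :: "real \<Rightarrow> real"
  assumes f: "continuous_on UNIV f"
    and avg: "\<And>s. 0 < s \<Longrightarrow> s \<le> pi \<Longrightarrow> integral {t-s..t+s} f \<le> 2 * s * c"
    and K: "\<And>s. (K has_real_derivative K' s) (at s)" "\<And>s. 0 \<le> K s" "\<And>s. K (-s) = K s"
    and K': "\<And>s. 0 \<le> s \<Longrightarrow> s \<le> pi \<Longrightarrow> K' s \<le> 0"
  shows "integral {-pi..pi} (\<lambda>s. K s * (f (t + s) - c)) \<le> 0"
proof -
  have contK: "continuous_on S K" for S
    using K(1) by (meson DERIV_isCont continuous_at_imp_continuous_on)
  have contf: "continuous_on S f" for S
    using f continuous_on_subset by blast
  \<comment> \<open>The radius 4 exceeds pi, so all points within pi of t are interior and the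
    derivative there is two-sided.\<close>
  obtain g where g: "\<And>x. x \<in> {t-4..t+4} \<Longrightarrow> (g has_vector_derivative f x) (at x within {t-4..t+4})"
    using antiderivative_continuous[OF contf] by blast
  have g': "(g has_real_derivative f x) (at x)" if "\<bar>x - t\<bar> < 4" for x
  proof -
    have "t - 4 < x" "x < t + 4" using that by linarith+
    then show ?thesis
      using g[of x] at_within_Icc_at[of "t-4" x "t+4"]
      by (simp add: has_real_derivative_iff_has_vector_derivative)
  qed
  define F where "F s = g (t+s) - g (t-s)" for s
  have F: "integral {t-s..t+s} f = F s" if "0 \<le> s" "s \<le> pi" for s
    unfolding F_def
  proof (rule integral_unique[OF fundamental_theorem_of_calculus])
    fix x assume "x \<in> {t-s..t+s}"
    then show "(g has_vector_derivative f x) (at x within {t-s..t+s})"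
      using g'[of x] that pi_less_4
      by (auto simp: has_real_derivative_iff_has_vector_derivative intro: has_vector_derivative_at_within)
  qed (use that in auto)
  define G' where "G' s = K' s * (F s - 2 * s * c) + K s * (f (t+s) + f (t-s) - 2 * c)" for s
  have G: "(G' has_integral (K pi * (F pi - 2 * pi * c) - K 0 * (F 0 - 2 * 0 * c))) {0..pi}"
  proof (rule fundamental_theorem_of_calculus)
    fix s assume s: "s \<in> {0..pi}"
    have "((\<lambda>s. K s * (F s - 2 * s * c)) has_real_derivative G' s) (at s)"
      unfolding F_def G'_def
      by (rule derivative_eq_intros K(1) DERIV_chain2[OF g'] refl | (use s pi_less_4 in force))+
    then show "((\<lambda>s. K s * (F s - 2 * s * c)) has_vector_derivative G' s) (at s within {0..pi})"
      by (simp add: has_real_derivative_iff_has_vector_derivative has_vector_derivative_at_within)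
  qed simp
  have Fle: "F s \<le> 2 * s * c" if "0 \<le> s" "s \<le> pi" for s
    using F[OF that] avg[of s] that by (cases "s = 0") (auto simp: F_def)
  define q where "q s = K s * (f (t + s) - c)" for s
  have contq: "continuous_on S q" "continuous_on S (\<lambda>s. q (-s))" for S
    unfolding q_def by (intro continuous_intros continuous_on_compose2[OF contK] continuous_on_compose2[OF contf]; force)+
  have intq: "q integrable_on {a..b}" "(\<lambda>s. q (-s)) integrable_on {a..b}" for a b
    by (rule integrable_continuous_interval contq)+
  \<comment> \<open>The negative half is reflected onto the positive one; evenness of K then gives
    the combination of f (t + s) and f (t - s) that occurs in \<open>G'\<close>.\<close>
  have "integral {-pi..pi} q = integral {-pi..0} q + integral {0..pi} q"
    by (rule Henstock_Kurzweil_Integration.integral_combine[symmetric]) (use intq in auto)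
  also have "integral {-pi..0} q = integral {0..pi} (\<lambda>s. q (-s))"
    using Henstock_Kurzweil_Integration.integral_reflect_real[of pi 0 "\<lambda>s. q (-s)"] by simp
  also have "\<dots> + integral {0..pi} q = integral {0..pi} (\<lambda>s. q (-s) + q s)"
    by (intro Henstock_Kurzweil_Integration.integral_add[symmetric] intq)
  also have "\<dots> \<le> integral {0..pi} G'"
  proof (rule integral_le)
    show "(\<lambda>s. q (-s) + q s) integrable_on {0..pi}"
      by (intro integrable_add intq)
    show "G' integrable_on {0..pi}" using G by blast
    fix s assume "s \<in> {0..pi}"
    then have "0 \<le> K' s * (F s - 2 * s * c)"
      using K'[of s] Fle[of s] by (intro mult_nonpos_nonpos) auto
    then show "q (-s) + q s \<le> G' s"
      unfolding G'_def q_def K(3) by (simp add: algebra_simps)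
  qed
  also have "\<dots> = K pi * (F pi - 2 * pi * c)"
    using integral_unique[OF G] by (simp add: F_def)
  also have "\<dots> \<le> 0"
    using Fle[of pi] K(2)[of pi] by (simp add: mult_nonneg_nonpos)
  finally show ?thesis unfolding q_def .
qed

lemma poisson_kernel_real:
  "poisson_kernel (of_real r) s = (1 - r\<^sup>2) / (1 - 2 * r * cos s + r\<^sup>2)"
proof -
  have "(cmod (cis s - of_real r))\<^sup>2 = (cos s - r)\<^sup>2 + (sin s)\<^sup>2"
    by (simp add: cmod_power2)
  also have "\<dots> = 1 - 2 * r * cos s + r\<^sup>2"
    using sin_cos_squared_add[of s] by (simp add: power2_diff)
  finally show ?thesis by (simp add: poisson_kernel_def)
qed

lemma Poisson_formula_rotated:
  assumes f: "f holomorphic_on ball 0 R" "1 < R" and r: "0 \<le> r" "r < 1"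
  shows "((\<lambda>s. of_real (poisson_kernel (of_real r) s) * f (cis (t + s))) has_integral
           of_real (2*pi) * f (of_real r * cis t)) {-pi..pi}"
proof -
  \<comment> \<open>The factor \<open>cis t\<close> moves the point to the real axis. The minus sign
    is a rotation by pi, which turns \<open>{0..2*pi}\<close> into the interval
    \<open>{-pi..pi}\<close> centred at the peak of the kernel.\<close>
  define g where "g z = f (- z * cis t)" for z
  have "g holomorphic_on ball 0 R"
    unfolding g_def
    by (rule holomorphic_on_compose_gen[of "\<lambda>z. - z * cis t", OF _ f(1), unfolded o_def])
       (auto intro!: holomorphic_intros simp: norm_mult)
  from Poisson_formula[OF this f(2), of "- of_real r"] r
  have "((\<lambda>s. of_real (poisson_kernel (- of_real r) s) * g (cis s)) has_integral
           of_real (2*pi) * f (of_real r * cis t)) {-pi+pi..pi+pi}"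
    by (simp add: g_def)
  then have "((\<lambda>s. of_real (poisson_kernel (- of_real r) (pi + s)) * g (cis (pi + s))) has_integral
           of_real (2*pi) * f (of_real r * cis t)) {-pi..pi}"
    unfolding has_integral_shift_Icc_real[symmetric] o_def .
  moreover have "poisson_kernel (- of_real r) (pi + s) = poisson_kernel (of_real r) s" for s
    using poisson_kernel_real[of r s] poisson_kernel_real[of "-r" "pi+s"] by simp
  moreover have "g (cis (pi + s)) = f (cis (t + s))" for s
    by (simp add: g_def cis_mult[symmetric] mult.commute)
  ultimately show ?thesis by simp
qed

text \<open>If every centred average of |f| were at most c, the even decreasing Poisson kernel, of
  total mass 2*pi, would give a Poisson average at most c, contradicting the value of |f| at the
  point.\<close>

lemma large_average_of_large_Poisson:
  assumes f: "f holomorphic_on ball 0 R" "1 < R" and r: "0 \<le> r" "r < 1"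
    and c: "c < cmod (f (of_real r * cis t))"
  shows "\<exists>s. 0 < s \<and> s \<le> pi \<and> 2 * s * c < integral {t-s..t+s} (\<lambda>x. cmod (f (cis x)))"
proof (rule ccontr)
  assume neg: "\<not> ?thesis"
  define K where "K s = (1 - r\<^sup>2) / (1 - 2 * r * cos s + r\<^sup>2)" for s
  define K' where "K' s = - ((1 - r\<^sup>2) * (2 * r * sin s) / (1 - 2 * r * cos s + r\<^sup>2)\<^sup>2)" for s
  have pos: "0 < 1 - 2 * r * cos s + r\<^sup>2" for s
  proof -
    have "0 < (1 - r)\<^sup>2" using r by simp
    also have "\<dots> \<le> 1 - 2 * r * cos s + r\<^sup>2"
      using r mult_left_mono[of "cos s" 1 "2 * r"] by (simp add: power2_diff)
    finally show ?thesis .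
  qed
  have r2: "r\<^sup>2 \<le> 1" using r by (simp add: power_le_one)
  have contf: "continuous_on UNIV (\<lambda>x. cmod (f (cis x)))"
    by (intro continuous_intros continuous_on_compose2[OF holomorphic_on_imp_continuous_on[OF f(1)]])
       (use f in auto)
  have dK: "(K has_real_derivative K' s) (at s)" for s
    unfolding K_def K'_def using pos[of s]
    by (auto intro!: derivative_eq_intros simp: power2_eq_square)
  have K0: "0 \<le> K s" for s
    unfolding K_def using pos[of s] r2 by simp
  have le0: "integral {-pi..pi} (\<lambda>s. K s * (cmod (f (cis (t + s))) - c)) \<le> 0"
  proof (rule decreasing_kernel_average[OF contf])
    show "integral {t-s..t+s} (\<lambda>x. cmod (f (cis x))) \<le> 2 * s * c" if "0 < s" "s \<le> pi" for s
      using neg that by force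
    show "K' s \<le> 0" if "0 \<le> s" "s \<le> pi" for s
      unfolding K'_def using that r r2 by (simp add: sin_ge_zero)
    show "K (- s) = K s" for s
      by (simp add: K_def)
  qed (rule dK K0)+
  have contK: "continuous_on S K" for S
    using dK by (meson DERIV_isCont continuous_at_imp_continuous_on)
  have intK: "(\<lambda>s. K s * cmod (f (cis (t+s)))) integrable_on {-pi..pi}" "(\<lambda>s. c * K s) integrable_on {-pi..pi}"
    by (rule integrable_continuous_interval; intro continuous_intros contK continuous_on_compose2[OF contf]; auto)+
  have "integral {-pi..pi} (\<lambda>s. K s * (cmod (f (cis (t + s))) - c)) =
     integral {-pi..pi} (\<lambda>s. K s * cmod (f (cis (t+s))) - c * K s)"
    by (simp add: algebra_simps)
  also have "\<dots> = integral {-pi..pi} (\<lambda>s. K s * cmod (f (cis (t+s)))) - integral {-pi..pi} (\<lambda>s. c * K s)"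
    by (rule Henstock_Kurzweil_Integration.integral_diff[OF intK])
  also have "integral {-pi..pi} (\<lambda>s. c * K s) = c * (2 * pi)"
  proof -
    have "((\<lambda>s. complex_of_real (K s)) has_integral of_real (2*pi)) {-pi..pi}"
      using Poisson_formula_rotated[of "\<lambda>_. 1" 2 r t] r
      unfolding poisson_kernel_real K_def by simp
    from has_integral_linear[OF this bounded_linear_Re] have "(K has_integral 2*pi) {-pi..pi}"
      by (simp add: o_def)
    then show ?thesis by (simp add: integral_unique)
  qed
  finally have le: "integral {-pi..pi} (\<lambda>s. K s * cmod (f (cis (t+s)))) \<le> c * (2 * pi)"
    using le0 by linarith
  have P: "((\<lambda>s. of_real (K s) * f (cis (t + s))) has_integral of_real (2*pi) * f (of_real r * cis t)) {-pi..pi}"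
    using Poisson_formula_rotated[OF f r, of t] unfolding poisson_kernel_real K_def .
  have "cmod (integral {-pi..pi} (\<lambda>s. of_real (K s) * f (cis (t + s)))) \<le>
      integral {-pi..pi} (\<lambda>s. K s * cmod (f (cis (t+s))))"
  proof (rule integral_norm_bound_integral)
    show "(\<lambda>s. of_real (K s) * f (cis (t + s))) integrable_on {-pi..pi}"
      using P by blast
    show "cmod (of_real (K s) * f (cis (t + s))) \<le> K s * cmod (f (cis (t+s)))" for s
      using K0[of s] by (simp add: norm_mult)
  qed (rule intK)
  then have "2 * pi * cmod (f (of_real r * cis t)) \<le> integral {-pi..pi} (\<lambda>s. K s * cmod (f (cis (t+s))))"
    using integral_unique[OF P] by (simp add: norm_mult)
  also note le
  finally have "cmod (f (of_real r * cis t)) \<le> c" by simp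
  then show False using c by linarith
qed

text \<open>Each exceptional t is the centre of an interval on which |f| has average above c;
  Vitali's lemma picks disjoint ones whose fivefold enlargements cover. The constant is 15 = 5 * 3:
  5 is the enlargement factor, and 3 counts the periods in \<open>{-2*pi..4*pi}\<close>, which
  contains every interval centred in \<open>{0..2*pi}\<close> with radius at most pi.\<close>

lemma Poisson_maximal_weak_type:
  assumes f: "f holomorphic_on ball 0 R" "1 < R" and c: "0 < c"
  obtains T where "T \<in> lmeasurable"
    "{t \<in> {0..2*pi}. \<exists>r. 0 \<le> r \<and> r < 1 \<and> c < cmod (f (of_real r * cis t))} \<subseteq> T"
    "measure lebesgue T \<le> 15 / c * integral {0..2*pi} (\<lambda>x. cmod (f (cis x)))"
proof -
  define E where "E = {t \<in> {0..2*pi}. \<exists>r. 0 \<le> r \<and> r < 1 \<and> c < cmod (f (of_real r * cis t))}"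
  define g where "g x = cmod (f (cis x))" for x
  have contg: "continuous_on S g" for S
    unfolding g_def
    by (intro continuous_intros continuous_on_compose2[OF holomorphic_on_imp_continuous_on[OF f(1)]])
       (use f in auto)
  have intg: "g integrable_on {a..b}" for a b
    by (rule integrable_continuous_interval contg)+
  have "\<exists>s. 0 < s \<and> s \<le> pi \<and> 2 * s * c < integral {t-s..t+s} g" if "t \<in> E" for t
    using that large_average_of_large_Poisson[OF f] unfolding E_def g_def by blast
  then obtain s where s: "\<And>t. t \<in> E \<Longrightarrow> 0 < s t \<and> s t \<le> pi \<and> 2 * s t * c < integral {t - s t..t + s t} g"
    by metis
  obtain C where C: "countable C" "C \<subseteq> E"
     "pairwise (\<lambda>i j. disjnt (cball i (s i)) (cball j (s j))) C"
     "E \<subseteq> (\<Union>i\<in>C. cball i (5 * s i))"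
    by (rule Vitali_covering_lemma_cballs[where S = E and K = E and a = "\<lambda>x. x" and r = s and B = pi]) (use s in force)+
  have period: "integral {-2*pi..4*pi} g = 3 * integral {0..2*pi} g"
  proof -
    have I: "(g has_integral integral {0..2*pi} g) {0..2*pi}"
      using intg by blast
    have "g \<circ> (+) (2*pi) = g" "g \<circ> (+) (-(2*pi)) = g"
      by (auto simp: g_def o_def fun_eq_iff cis_divide[symmetric] cis_mult[symmetric])
    then have "(g has_integral integral {0..2*pi} g) {2*pi..4*pi}"
      "(g has_integral integral {0..2*pi} g) {-2*pi..0}"
      using has_integral_shift_Icc_real[of g "2*pi" "integral {0..2*pi} g" 0 "2*pi"]
        has_integral_shift_Icc_real[of g "-(2*pi)" "integral {0..2*pi} g" 0 "2*pi"] I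
      by (simp_all add: algebra_simps)
    then have "(g has_integral integral {0..2*pi} g + integral {0..2*pi} g + integral {0..2*pi} g) {-2*pi..4*pi}"
      using I by (intro has_integral_combine[of "-2*pi" "2*pi"] has_integral_combine[of "-2*pi" 0]) auto
    then show ?thesis by (simp add: integral_unique)
  qed
  \<comment> \<open>A bound uniform over finite subfamilies makes the countable union measurable
    with the same bound.\<close>
  have bound: "measure lebesgue (\<Union>i\<in>I. cball i (5 * s i)) \<le> 15 / c * integral {0..2*pi} g"
    if I: "I \<subseteq> C" "finite I" for I
  proof -
    have IE: "i \<in> E" if "i \<in> I" for i using that I C by blast
    have ball: "cball i (s i) = {i - s i..i + s i}" for i
      by (rule cball_eq_atLeastAtMost)
    have U: "(g has_integral (\<Sum>i\<in>I. integral {i - s i..i + s i} g)) (\<Union>i\<in>I. cball i (s i))"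
    proof (rule has_integral_UN[OF I(2)])
      show "(g has_integral integral {i - s i..i + s i} g) (cball i (s i))" for i
        unfolding ball using intg by blast
      show "pairwise (\<lambda>i i'. negligible (cball i (s i) \<inter> cball i' (s i'))) I"
        using pairwise_subset[OF C(3) I(1)] by (auto simp: pairwise_def disjnt_def)
    qed
    have "measure lebesgue (\<Union>i\<in>I. cball i (5 * s i)) \<le> (\<Sum>i\<in>I. measure lebesgue (cball i (5 * s i)))"
      by (rule measure_UNION_le[OF I(2)]) auto
    also have "\<dots> = (\<Sum>i\<in>I. 10 * s i)"
    proof (rule sum.cong[OF refl])
      fix i assume "i \<in> I"
      then have "0 < s i" using s IE by blast
      then show "measure lebesgue (cball i (5 * s i)) = 10 * s i"
        by (simp add: cball_eq_atLeastAtMost)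
    qed
    also have "\<dots> \<le> (\<Sum>i\<in>I. 5 / c * integral {i - s i..i + s i} g)"
      using s[OF IE] c by (intro sum_mono) (force simp: field_simps)
    also have "\<dots> = 5 / c * integral (\<Union>i\<in>I. cball i (s i)) g"
      using integral_unique[OF U] by (simp add: sum_distrib_left)
    also have "integral (\<Union>i\<in>I. cball i (s i)) g \<le> integral {-2*pi..4*pi} g"
    proof (rule integral_subset_le)
      show "(\<Union>i\<in>I. cball i (s i)) \<subseteq> {-2*pi..4*pi}"
        using s[OF IE] IE unfolding ball E_def by fastforce
    qed (use U intg in \<open>auto simp: g_def\<close>)
    finally show ?thesis
      using c period by (simp add: field_simps)
  qed
  show thesis
  proof
    show "(\<Union>i\<in>C. cball i (5 * s i)) \<in> lmeasurable"
      by (rule fmeasurable_UN_bound[OF C(1) _ bound]) auto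
    show "measure lebesgue (\<Union>i\<in>C. cball i (5 * s i)) \<le> 15 / c * integral {0..2*pi} (\<lambda>x. cmod (f (cis x)))"
      by (rule measure_UN_bound[OF C(1) _ bound, unfolded g_def[abs_def]]) auto
  qed (use C(4) E_def in auto)
qed

text \<open>The previous estimate is applied to f^2 at level c^2, since |f| > c means |f^2| > c^2
  and the mean of |f^2| is \<open>mean_sq\<close>. Dilating by \<open>\<rho> n\<close> makes the
  function holomorphic across the circle, and the sets \<open>D n\<close> increase to E. The
  constant is 15 times the length 2*pi.\<close>

lemma hardy2_maximal_weak_type:
  assumes f: "f holomorphic_on ball 0 1" and c: "0 < c"
    and B: "\<And>r. 0 \<le> r \<Longrightarrow> r < 1 \<Longrightarrow> mean_sq f r \<le> B"
  defines "E \<equiv> {t \<in> {0..2*pi}. \<exists>r. 0 \<le> r \<and> r < 1 \<and> c < cmod (f (of_real r * cis t))}"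
  shows "E \<in> lmeasurable" "measure lebesgue E \<le> 30 * pi * B / c\<^sup>2"
proof -
  define \<rho> where "\<rho> n = 1 - 1 / (real n + 2)" for n
  have \<rho>: "0 < \<rho> n" "\<rho> n < 1" for n
    by (auto simp: \<rho>_def field_simps)
  have mono: "\<rho> m \<le> \<rho> n" if "m \<le> n" for m n
    using that by (auto simp: \<rho>_def field_simps)
  define D where "D n = {t \<in> {0..2*pi}. \<exists>r. 0 \<le> r \<and> r < \<rho> n \<and> c < cmod (f (of_real r * cis t))}" for n
  have D_mono: "D m \<subseteq> D n" if "m \<le> n" for m n
    unfolding D_def using mono[OF that] by force
  have ex: "\<exists>n. r < \<rho> n" if "r < 1" for r
  proof -
    have "0 < 1 - r" using that by simp
    from reals_Archimedean[OF this] obtain n where "inverse (real (Suc n)) < 1 - r" ..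
    moreover have "1 / (real n + 2) \<le> inverse (real (Suc n))"
      by (simp add: field_simps)
    ultimately show ?thesis unfolding \<rho>_def by (intro exI[of _ n]) linarith
  qed
  have E_UN: "E = (\<Union>n. D n)"
  proof
    show "E \<subseteq> (\<Union>n. D n)" unfolding E_def D_def using ex by blast
    show "(\<Union>n. D n) \<subseteq> E" unfolding E_def D_def using less_trans[OF _ \<rho>(2)] by blast
  qed
  have D_meas: "D n \<in> lmeasurable" for n
  proof (rule bounded_set_imp_lmeasurable)
    show "bounded (D n)" by (rule bounded_subset[of "{0..2*pi}"]) (auto simp: D_def)
    have "D n = {0..2*pi} \<inter> (\<Union>r\<in>{0..<\<rho> n}. {t. c < cmod (f (of_real r * cis t))})"
      by (auto simp: D_def)
    \<comment> \<open>Measurability is seen from this form: an interval intersected with a union,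
      possibly uncountable, of open sets.\<close>
    moreover have "open {t. c < cmod (f (of_real r * cis t))}" if "r \<in> {0..<\<rho> n}" for r
      by (intro open_Collect_less continuous_intros continuous_on_compose2[OF holomorphic_on_imp_continuous_on[OF f]])
         (use that \<rho>(2)[of n] in \<open>auto simp: norm_mult\<close>)
    then have "open (\<Union>r\<in>{0..<\<rho> n}. {t. c < cmod (f (of_real r * cis t))})"
      by blast
    ultimately show "D n \<in> sets lebesgue" by auto
  qed
  have D_bound: "measure lebesgue (D n) \<le> 30 * pi * B / c\<^sup>2" for n
  proof -
    define g where "g z = (f (of_real (\<rho> n) * z))\<^sup>2" for z
    have g: "g holomorphic_on ball 0 (1 / \<rho> n)"
      unfolding g_def
      by (intro holomorphic_intros holomorphic_on_compose_gen[of "\<lambda>z. of_real (\<rho> n) * z", OF _ f, unfolded o_def])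
         (use \<rho>[of n] in \<open>auto simp: norm_mult field_simps\<close>)
    obtain T where T: "T \<in> lmeasurable"
      "{t \<in> {0..2*pi}. \<exists>r. 0 \<le> r \<and> r < 1 \<and> c\<^sup>2 < cmod (g (of_real r * cis t))} \<subseteq> T"
      "measure lebesgue T \<le> 15 / c\<^sup>2 * integral {0..2*pi} (\<lambda>x. cmod (g (cis x)))"
      using Poisson_maximal_weak_type[OF g, of "c\<^sup>2"] \<rho>[of n] c by auto
    have "D n \<subseteq> T"
    proof
      fix t assume "t \<in> D n"
      then obtain r where t: "t \<in> {0..2*pi}" and r: "0 \<le> r" "r < \<rho> n" "c < cmod (f (of_real r * cis t))"
        by (auto simp: D_def)
      have "c\<^sup>2 < (cmod (f (of_real r * cis t)))\<^sup>2"
        using r c by (intro power_strict_mono) auto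
      also have "\<dots> = cmod (g (of_real (r / \<rho> n) * cis t))"
        using \<rho>[of n] by (simp add: g_def norm_power)
      finally have "0 \<le> r / \<rho> n \<and> r / \<rho> n < 1 \<and> c\<^sup>2 < cmod (g (of_real (r / \<rho> n) * cis t))"
        using r \<rho>[of n] by auto
      then show "t \<in> T" using T(2) t by blast
    qed
    then have "measure lebesgue (D n) \<le> measure lebesgue T"
      using D_meas T(1) by (intro measure_mono_fmeasurable) (auto simp: fmeasurableD)
    also have "\<dots> \<le> 15 / c\<^sup>2 * (2 * pi * mean_sq f (\<rho> n))"
      using T(3) by (simp add: g_def mean_sq_def norm_power)
    also have "\<dots> \<le> 15 / c\<^sup>2 * (2 * pi * B)"
      using B[of "\<rho> n"] \<rho>[of n] c by (intro mult_left_mono) auto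
    finally show ?thesis by (simp add: field_simps)
  qed
  have bound: "measure lebesgue (\<Union>n\<in>I. D n) \<le> 30 * pi * B / c\<^sup>2" if "finite I" for I
  proof -
    have "(\<Union>n\<in>I. D n) \<subseteq> D (Max (insert 0 I))"
      using D_mono[OF Max_ge[of "insert 0 I"]] that by blast
    then have "measure lebesgue (\<Union>n\<in>I. D n) \<le> measure lebesgue (D (Max (insert 0 I)))"
      using D_meas by (intro measure_mono_fmeasurable sets.countable_UN'') (auto simp: fmeasurableD countable_finite that)
    with D_bound show ?thesis by (meson order.trans)
  qed
  show "E \<in> lmeasurable"
    unfolding E_UN by (rule fmeasurable_UN_bound[OF _ _ bound]) (use D_meas in auto)
  show "measure lebesgue E \<le> 30 * pi * B / c\<^sup>2"
    unfolding E_UN by (rule measure_UN_bound[OF _ _ bound]) (use D_meas in auto)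
qed

section \<open>Existence of radial limits\<close>

text \<open>The Cauchy criterion, with tolerances restricted to reciprocals of integers so that the
  points without a limit lie in a countable union of oscillation sets.\<close>

lemma has_radial_limit_if_Cauchy:
  assumes "\<And>n::nat. \<exists>r0<1. \<forall>r r'. r0 < r \<longrightarrow> r < 1 \<longrightarrow> r0 < r' \<longrightarrow> r' < 1 \<longrightarrow>
     dist (f (of_real r * cis t)) (f (of_real r' * cis t)) \<le> inverse (real (Suc n))"
  shows "has_radial_limit f t"
proof -
  have "cauchy_filter (filtermap (\<lambda>r::real. f (of_real r * cis t)) (at_left 1))"
    unfolding cauchy_filter_metric_filtermap
  proof (intro allI impI)
    fix e :: real assume "e > 0"
    then obtain n where n: "inverse (real (Suc n)) < e" using reals_Archimedean by blast
    obtain r0 where r0: "r0 < 1" "\<forall>r r'. r0 < r \<longrightarrow> r < 1 \<longrightarrow> r0 < r' \<longrightarrow> r' < 1 \<longrightarrow>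
       dist (f (of_real r * cis t)) (f (of_real r' * cis t)) \<le> inverse (real (Suc n))"
      using assms by blast
    have "eventually (\<lambda>r. r0 < r \<and> r < 1) (at_left 1)"
      using r0(1) eventually_at_left_real by auto
    then show "\<exists>P. eventually P (at_left 1) \<and>
       (\<forall>x y. P x \<and> P y \<longrightarrow> dist (f (of_real x * cis t)) (f (of_real y * cis t)) < e)"
      using r0(2) n by (intro exI[of _ "\<lambda>r. r0 < r \<and> r < 1"]) force
  qed
  moreover have "filtermap (\<lambda>r::real. f (of_real r * cis t)) (at_left 1) \<noteq> bot"
    by (simp add: filtermap_bot_iff)
  ultimately obtain L where "filtermap (\<lambda>r::real. f (of_real r * cis t)) (at_left 1) \<le> nhds L"
    using cauchy_filter_complete_converges[OF _ complete_UNIV] by auto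
  then show ?thesis
    unfolding has_radial_limit_def filterlim_def by blast
qed

text \<open>The oscillation at the boundary is unchanged when a Taylor polynomial is subtracted, and the
  remainder has a small maximal function.\<close>
theorem Fatou_radial_limits:
  assumes f: "hardy2 f"
  shows "negligible {t \<in> {0..2*pi}. \<not> has_radial_limit f t}"
proof -
  have hol: "f holomorphic_on ball 0 1" using f by (simp add: hardy2_def)
  define a where "a = taylor_coeff f"
  define osc where "osc \<epsilon> = {t \<in> {0..2*pi}. \<not> (\<exists>r0<1. \<forall>r r'. r0 < r \<longrightarrow> r < 1 \<longrightarrow> r0 < r' \<longrightarrow> r' < 1 \<longrightarrow>
     dist (f (of_real r * cis t)) (f (of_real r' * cis t)) \<le> \<epsilon>)}" for \<epsilon>
  have sa: "summable (\<lambda>n. (cmod (a n))\<^sup>2)" using f by (simp add: hardy2_def a_def)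
  have "negligible (osc \<epsilon>)" if \<epsilon>: "\<epsilon> > 0" for \<epsilon>
    unfolding negligible_outer_le
  proof (intro allI impI)
    fix e :: real assume e: "e > 0"
    \<comment> \<open>Two radii are compared through f, p, the boundary value of p, p and f again:
      four distances, each at most c.\<close>
    define c where "c = \<epsilon> / 4"
    have c: "c > 0" using \<epsilon> by (simp add: c_def)
    \<comment> \<open>Solved from \<open>30 * pi * \<delta> / c\<^sup>2 = e\<close>, the weak-type
      bound for a remainder with circle means at most \<open>\<delta>\<close>.\<close>
    define \<delta> where "\<delta> = e * c\<^sup>2 / (30 * pi)"
    have "\<delta> > 0" using e c by (simp add: \<delta>_def)
    then obtain N where N: "\<And>n. n \<ge> N \<Longrightarrow> norm (\<Sum>i. (cmod (a (i + n)))\<^sup>2) < \<delta>"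
      using suminf_exist_split[OF _ sa] by blast
    define p where "p z = (\<Sum>n<N. a n * z ^ n)" for z
    define b where "b n = (if n < N then 0 else a n)" for n
    have b: "(\<lambda>n. b n * z ^ n) sums (f z - p z)" if "cmod z < 1" for z
    proof -
      have "(\<lambda>n. a n * z ^ n - (if n \<in> {..<N} then a n * z ^ n else 0)) sums (f z - p z)"
        unfolding p_def a_def
        by (intro sums_diff taylor_coeff_sums[OF hol] sums_If_finite_set that) auto
      moreover have "a n * z ^ n - (if n \<in> {..<N} then a n * z ^ n else 0) = b n * z ^ n" for n
        by (simp add: b_def)
      ultimately show ?thesis by simp
    qed
    have sb: "(\<lambda>n. (cmod (b n))\<^sup>2) sums (\<Sum>i. (cmod (a (i + N)))\<^sup>2)"
    proof -
      have "(\<lambda>n. (cmod (b (n + N)))\<^sup>2) sums (\<Sum>i. (cmod (a (i + N)))\<^sup>2)"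
        unfolding b_def using summable_sums[OF summable_ignore_initial_segment[OF sa, of N]] by simp
      then show ?thesis by (subst (asm) sums_iff_shift) (simp add: b_def)
    qed
    have mean: "mean_sq (\<lambda>z. f z - p z) r \<le> \<delta>" if "0 \<le> r" "r < 1" for r
    proof -
      have "mean_sq (\<lambda>z. f z - p z) r \<le> (\<Sum>i. (cmod (a (i + N)))\<^sup>2)"
        by (rule sums_le[OF _ Parseval_power_series[OF b that] sb])
           (use that in \<open>auto intro!: mult_right_le_one_le power_le_one\<close>)
      with N[of N] show ?thesis by force
    qed
    have holg: "(\<lambda>z. f z - p z) holomorphic_on ball 0 1"
      unfolding p_def by (intro holomorphic_intros hol)
    let ?E = "{t \<in> {0..2*pi}. \<exists>r. 0 \<le> r \<and> r < 1 \<and> c < cmod (f (of_real r * cis t) - p (of_real r * cis t))}"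
    have "osc \<epsilon> \<subseteq> ?E"
    proof
      fix t assume t: "t \<in> osc \<epsilon>"
      show "t \<in> ?E"
      proof (rule ccontr)
        assume "t \<notin> ?E"
        then have small: "cmod (f (of_real r * cis t) - p (of_real r * cis t)) \<le> c" if "0 \<le> r" "r < 1" for r
          using t that by (force simp: osc_def)
        \<comment> \<open>The polynomial is continuous up to the circle, so it adds nothing to the
          oscillation in the limit.\<close>
        have "((\<lambda>r::real. p (of_real r * cis t)) \<longlongrightarrow> p (of_real 1 * cis t)) (at_left 1)"
          unfolding p_def by (intro tendsto_intros)
        then have "eventually (\<lambda>r. dist (p (of_real r * cis t)) (p (of_real 1 * cis t)) < c) (at_left 1)"
          using c tendstoD by blast
        then obtain r1 where r1: "r1 < 1" "\<And>r. r1 < r \<Longrightarrow> r < 1 \<Longrightarrow> dist (p (of_real r * cis t)) (p (of_real 1 * cis t)) < c"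
          by (auto simp: eventually_at_left_field)
        have "dist (f (of_real r * cis t)) (f (of_real r' * cis t)) \<le> \<epsilon>"
          if "max 0 r1 < r" "r < 1" "max 0 r1 < r'" "r' < 1" for r r'
        proof -
          have "dist (f (of_real r * cis t)) (p (of_real r * cis t)) \<le> c"
               "dist (f (of_real r' * cis t)) (p (of_real r' * cis t)) \<le> c"
            using small[of r] small[of r'] that by (auto simp: dist_norm)
          moreover have "dist (p (of_real r * cis t)) (p (of_real 1 * cis t)) < c"
              "dist (p (of_real r' * cis t)) (p (of_real 1 * cis t)) < c"
            using r1(2)[of r] r1(2)[of r'] that by auto
          ultimately show ?thesis
            unfolding c_def by metric
        qed
        then have "t \<notin> osc \<epsilon>"
          using r1(1) unfolding osc_def by (auto intro!: exI[of _ "max 0 r1"])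
        with t show False by contradiction
      qed
    qed
    moreover have "?E \<in> lmeasurable"
      using hardy2_maximal_weak_type(1)[OF holg c mean] by simp
    moreover have "measure lebesgue ?E \<le> e"
      using hardy2_maximal_weak_type(2)[OF holg c mean] c by (simp add: \<delta>_def)
    ultimately show "\<exists>T. osc \<epsilon> \<subseteq> T \<and> T \<in> lmeasurable \<and> measure lebesgue T \<le> e"
      by blast
  qed
  then have "negligible (\<Union>n::nat. osc (inverse (real (Suc n))))"
    by (intro negligible_countable_Union) (auto simp del: of_nat_Suc)
  moreover have "{t \<in> {0..2*pi}. \<not> has_radial_limit f t} \<subseteq> (\<Union>n::nat. osc (inverse (real (Suc n))))"
  proof
    fix t assume t: "t \<in> {t \<in> {0..2*pi}. \<not> has_radial_limit f t}"
    then have "\<not> has_radial_limit f t" by simp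
    then obtain n :: nat where "\<not> (\<exists>r0<1. \<forall>r r'. r0 < r \<longrightarrow> r < 1 \<longrightarrow> r0 < r' \<longrightarrow> r' < 1 \<longrightarrow>
       dist (f (of_real r * cis t)) (f (of_real r' * cis t)) \<le> inverse (real (Suc n)))"
      using has_radial_limit_if_Cauchy[of f t] by metis
    then have "t \<in> osc (inverse (real (Suc n)))"
      using t unfolding osc_def by simp
    then show "t \<in> (\<Union>n::nat. osc (inverse (real (Suc n))))" by blast
  qed
  ultimately show ?thesis
    using negligible_subset by blast
qed

section \<open>Logarithmic means bounded by the Hilbert--Schmidt norm\<close>

text \<open>On the circle z and its conjugate are inverse, so each mixed monomial reduces to a power
  of z or of its conjugate, and the real part does not see conjugation. The induction splits off
  both constant terms and cancels one factor \<open>z * cnj z\<close> from the rest. It makes the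
  real parts of polynomials on the circle closed under products.\<close>

lemma Re_poly_times_cnj_poly_on_circle:
  fixes p q :: "complex poly"
  shows "\<exists>s. \<forall>z. cmod z = 1 \<longrightarrow> Re (poly p z * cnj (poly q z)) = Re (poly s z)"
proof (induction q arbitrary: p)
  case 0
  show ?case by (intro exI[of _ 0]) simp
next
  case (pCons a q)
  obtain b p' where p: "p = pCons b p'" by (rule pCons_cases)
  obtain s where s: "\<And>z. cmod z = 1 \<Longrightarrow> Re (poly p' z * cnj (poly q z)) = Re (poly s z)"
    using pCons.IH by blast
  show ?case
  proof (intro exI[of _ "smult (cnj a) p + smult (cnj b) (pCons 0 q) + s"] allI impI)
    fix z :: complex assume z: "cmod z = 1"
    then have zz: "z * cnj z = 1"
      by (simp add: complex_norm_square[symmetric])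
    have "poly p z * cnj (poly (pCons a q) z) =
        cnj a * poly p z + b * cnj (z * poly q z) + (z * cnj z) * (poly p' z * cnj (poly q z))"
      by (simp add: p algebra_simps)
    moreover have "Re (b * cnj (z * poly q z)) = Re (cnj b * (z * poly q z))"
      by (simp add: algebra_simps)
    ultimately show "Re (poly p z * cnj (poly (pCons a q) z)) =
        Re (poly (smult (cnj a) p + smult (cnj b) (pCons 0 q) + s) z)"
      using s[OF z] by (simp only: zz mult_1 plus_complex.simps poly_add poly_smult poly_pCons add_0)
  qed
qed

lemma real_polynomial_function_on_circle:
  assumes "real_polynomial_function g"
  shows "\<exists>p :: complex poly. \<forall>z. cmod z = 1 \<longrightarrow> g z = Re (poly p z)"
  using assms
proof induction
  case (linear f)
  then interpret bounded_linear f .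
  have "f z = Re (poly [:0, of_real (f 1) - \<i> * of_real (f \<i>):] z)" for z
  proof -
    have "z = Re z *\<^sub>R 1 + Im z *\<^sub>R \<i>"
      by (simp add: complex_eq_iff)
    then have "f z = Re z * f 1 + Im z * f \<i>"
      by (metis add scaleR real_scaleR_def)
    then show ?thesis by simp
  qed
  then show ?case by blast
next
  case (const c)
  show ?case by (intro exI[of _ "[:of_real c:]"]) simp
next
  case (add f g)
  then obtain p q where "\<forall>z. cmod z = 1 \<longrightarrow> f z = Re (poly p z)" "\<forall>z. cmod z = 1 \<longrightarrow> g z = Re (poly q z)"
    by blast
  then show ?case by (intro exI[of _ "p + q"]) simp
next
  case (mult f g)
  then obtain p q where pq: "\<forall>z. cmod z = 1 \<longrightarrow> f z = Re (poly p z)" "\<forall>z. cmod z = 1 \<longrightarrow> g z = Re (poly q z)"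
    by blast
  obtain s where s: "\<forall>z. cmod z = 1 \<longrightarrow> Re (poly p z * cnj (poly q z)) = Re (poly s z)"
    using Re_poly_times_cnj_poly_on_circle by blast
  \<comment> \<open>The identity Re P * Re Q = (Re (P Q) + Re (P cnj Q)) / 2.\<close>
  have "f z * g z = Re (poly (smult (1/2) (p * q + s)) z)" if "cmod z = 1" for z
    using that pq s[rule_format, OF that] by (simp add: field_simps)
  then show ?case by blast
qed

text \<open>Stone--Weierstrass in the real coordinates, followed by the reduction to holomorphic
  polynomials: their real parts are the log-moduli of the zero-free functions
  \<open>exp (poly p z)\<close>.\<close>

lemma continuous_on_circle_approx_Re_poly:
  assumes "continuous_on (sphere 0 1) u" "0 < e"
  obtains p :: "complex poly" where "\<And>z. cmod z = 1 \<Longrightarrow> \<bar>u z - Re (poly p z)\<bar> < e"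
proof -
  obtain g where g: "real_polynomial_function g" "\<And>z. z \<in> sphere 0 1 \<Longrightarrow> \<bar>u z - g z\<bar> < e"
    using Stone_Weierstrass_real_polynomial_function[OF compact_sphere assms] by blast
  obtain p where "\<And>z. cmod z = 1 \<Longrightarrow> g z = Re (poly p z)"
    using real_polynomial_function_on_circle[OF g(1)] by blast
  with g(2) show ?thesis by (intro that[of p]) force
qed

text \<open>The test function is \<open>h exp (p / 2)\<close> for a polynomial \<open>p\<close> whose real part is close to \<open>u\<close>.\<close>
lemma Szego_inequality:
  assumes h: "h holomorphic_on ball 0 R" "1 < R" and u: "continuous_on (sphere 0 1) u"
  shows "(cmod (h 0))\<^sup>2 * exp (integral {0..2*pi} (\<lambda>t. u (cis t)) / (2*pi))
       \<le> integral {0..2*pi} (\<lambda>t. (cmod (h (cis t)))\<^sup>2 * exp (u (cis t))) / (2*pi)"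
    (is "?A \<le> ?B")
proof -
  have conth: "continuous_on S (\<lambda>t. h (cis t))" for S
    by (intro continuous_on_compose2[OF holomorphic_on_imp_continuous_on[OF h(1)]] continuous_intros)
       (use h in auto)
  have contu: "continuous_on S (\<lambda>t. u (cis t))" for S
    by (intro continuous_on_compose2[OF u] continuous_intros) auto
  \<comment> \<open>The error e enters twice, once in replacing u by the real part of p in the mean
    and once in going back to \<open>exp u\<close>; hence the factor
    \<open>exp (2 * e)\<close>.\<close>
  have eps: "?A \<le> exp (2 * e) * ?B" if e: "e > 0" for e
  proof -
    obtain p where p: "\<And>z. cmod z = 1 \<Longrightarrow> \<bar>u z - Re (poly p z)\<bar> < e"
      using continuous_on_circle_approx_Re_poly[OF u e] by blast
    define F where "F z = exp (poly p z / 2)" for z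
    have F2: "(cmod (F z))\<^sup>2 = exp (Re (poly p z))" for z
      by (simp add: F_def power2_eq_square flip: exp_add)
    \<comment> \<open>At the centre the Poisson kernel is constantly 1, so this is the mean value
      property.\<close>
    have p0: "((\<lambda>t. Re (poly p (cis t))) has_integral 2 * pi * Re (poly p 0)) {0..2*pi}"
    proof -
      have "((\<lambda>t. poly p (cis t)) has_integral of_real (2*pi) * poly p 0) {0..2*pi}"
        using Poisson_formula[of "poly p" 2 0] by (simp add: poisson_kernel_def holomorphic_intros)
      from has_integral_linear[OF this bounded_linear_Re] show ?thesis by (simp add: o_def)
    qed
    have "integral {0..2*pi} (\<lambda>t. u (cis t)) \<le> integral {0..2*pi} (\<lambda>t. Re (poly p (cis t)) + e)"
    proof (rule integral_le)
      fix t
      show "u (cis t) \<le> Re (poly p (cis t)) + e" using p[of "cis t"] by simp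
    qed (intro integrable_continuous_interval contu continuous_intros)+
    also have "\<dots> = 2 * pi * Re (poly p 0) + 2 * pi * e"
      using has_integral_add[OF p0 has_integral_const_real[of e 0 "2*pi"]] by (simp add: integral_unique)
    finally have le: "integral {0..2*pi} (\<lambda>t. u (cis t)) / (2*pi) \<le> Re (poly p 0) + e"
      by (simp add: field_simps)
    have "?A \<le> (cmod (h 0))\<^sup>2 * exp (Re (poly p 0) + e)"
      using le by (intro mult_left_mono) auto
    also have "\<dots> = exp e * (cmod (h 0 * F 0))\<^sup>2"
      by (simp add: norm_mult power_mult_distrib F2 exp_add)
    also have "\<dots> \<le> exp e * mean_sq (\<lambda>z. h z * F z) 1"
      by (intro mult_left_mono norm_at_0_le_mean_sq[where R = R])
         (auto simp: F_def h intro!: holomorphic_intros)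
    also have "mean_sq (\<lambda>z. h z * F z) 1 \<le> exp e * ?B"
    proof -
      have "integral {0..2*pi} (\<lambda>t. (cmod (h (cis t) * F (cis t)))\<^sup>2) \<le>
         integral {0..2*pi} (\<lambda>t. exp e * ((cmod (h (cis t)))\<^sup>2 * exp (u (cis t))))"
      proof (rule integral_le)
        show "(\<lambda>t. (cmod (h (cis t) * F (cis t)))\<^sup>2) integrable_on {0..2*pi}"
          unfolding F_def by (intro integrable_continuous_interval continuous_intros conth) auto
        show "(\<lambda>t. exp e * ((cmod (h (cis t)))\<^sup>2 * exp (u (cis t)))) integrable_on {0..2*pi}"
          by (intro integrable_continuous_interval continuous_intros conth contu)
        fix t
        have "exp (Re (poly p (cis t))) \<le> exp e * exp (u (cis t))"
          using p[of "cis t"] by (simp flip: exp_add)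
        then have "(cmod (h (cis t)))\<^sup>2 * exp (Re (poly p (cis t))) \<le> (cmod (h (cis t)))\<^sup>2 * (exp e * exp (u (cis t)))"
          by (intro mult_left_mono) auto
        then show "(cmod (h (cis t) * F (cis t)))\<^sup>2 \<le> exp e * ((cmod (h (cis t)))\<^sup>2 * exp (u (cis t)))"
          by (simp add: norm_mult power_mult_distrib F2 mult_ac)
      qed
      then show ?thesis by (simp add: mean_sq_def divide_right_mono)
    qed
    finally show ?thesis
      by (simp add: exp_double power2_eq_square)
  qed
  have "((\<lambda>e. exp (2 * e) * ?B) \<longlongrightarrow> exp (2 * 0) * ?B) (at_right 0)"
    by (intro tendsto_intros)
  moreover have "eventually (\<lambda>e. ?A \<le> exp (2 * e) * ?B) (at_right 0)"
    using eps by (auto simp: eventually_at_right_field intro!: exI[of _ 1])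
  ultimately have "?A \<le> exp (2 * 0) * ?B"
    by (rule tendsto_lowerbound) simp
  then show ?thesis by simp
qed

section \<open>Bounds for the logarithmic means\<close>

text \<open>The exponent is the index of the first nonzero Taylor coefficient, and the cofactor is
  the sum of the shifted series. It yields a function that does not vanish at the point where
  Szego's inequality is evaluated.\<close>

lemma holomorphic_factor_power_at_0:
  assumes w: "w holomorphic_on ball 0 1" and nz: "z0 \<in> ball 0 1" "w z0 \<noteq> 0"
  obtains k v where "v holomorphic_on ball 0 1" "v 0 \<noteq> 0" "\<And>z. cmod z < 1 \<Longrightarrow> w z = z ^ k * v z"
proof -
  define a where "a = taylor_coeff w"
  have a: "(\<lambda>n. a n * z ^ n) sums w z" if "cmod z < 1" for z
    unfolding a_def by (rule taylor_coeff_sums[OF w that])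
  have "\<exists>n. a n \<noteq> 0"
  proof (rule ccontr)
    assume "\<not> ?thesis"
    then have "w z0 = 0" using a[of z0] nz by (simp add: sums_iff)
    with nz show False by simp
  qed
  define k where "k = (LEAST n. a n \<noteq> 0)"
  have k: "a k \<noteq> 0" "\<And>n. n < k \<Longrightarrow> a n = 0"
    unfolding k_def using LeastI_ex[OF \<open>\<exists>n. a n \<noteq> 0\<close>] not_less_Least by blast+
  define v where "v z = (if z = 0 then a k else w z / z ^ k)" for z
  have v: "(\<lambda>n. a (n + k) * z ^ n) sums v z" if z: "cmod z < 1" for z
  proof (cases "z = 0")
    case True
    then show ?thesis using powser_sums_zero[of "\<lambda>n. a (n + k)"] by (simp add: v_def)
  next
    case False
    have "(\<lambda>n. a (n + k) * z ^ (n + k)) sums w z"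
      using a[OF z] by (subst sums_iff_shift) (simp add: k(2))
    from sums_divide[OF this, of "z ^ k"] show ?thesis
      using False by (simp add: v_def power_add)
  qed
  show thesis
  proof
    show "v holomorphic_on ball 0 1"
      by (rule power_series_holomorphic[where a = "\<lambda>n. a (n + k)"]) (use v in auto)
    show "v 0 \<noteq> 0" using k by (simp add: v_def)
    show "w z = z ^ k * v z" if "cmod z < 1" for z
    proof (cases "z = 0")
      case True
      have "w 0 = a 0" by (simp add: a_def taylor_coeff_def)
      with True k show ?thesis by (cases k) (auto simp: v_def)
    qed (simp add: v_def)
  qed
qed

text \<open>A geometric series in |phi|^2 produces the denominator. Its terms are nonnegative, so
  the limit itself dominates the partial sums, and it is continuous on a circle of radius r <
  1.\<close>

lemma weighted_mean_le_sum_h2norm: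
  assumes hol: "w holomorphic_on ball 0 1" "\<phi> holomorphic_on ball 0 1"
    and \<phi>: "\<And>z. cmod z < 1 \<Longrightarrow> cmod (\<phi> z) < 1"
    and h2: "\<And>n. hardy2 (\<lambda>z. w z * \<phi> z ^ n)"
    and sm: "summable (\<lambda>n. (h2norm (\<lambda>z. w z * \<phi> z ^ n))\<^sup>2)"
    and r: "0 \<le> r" "r < 1"
  shows "integral {0..2*pi} (\<lambda>t. (cmod (w (of_real r * cis t)))\<^sup>2 / (1 - (cmod (\<phi> (of_real r * cis t)))\<^sup>2)) / (2*pi)
    \<le> (\<Sum>n. (h2norm (\<lambda>z. w z * \<phi> z ^ n))\<^sup>2)" (is "?J / _ \<le> ?M")
proof -
  define W where "W t = cmod (w (of_real r * cis t))" for t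
  define x where "x t = (cmod (\<phi> (of_real r * cis t)))\<^sup>2" for t
  have cont: "continuous_on S W" "continuous_on S x" for S
    unfolding W_def x_def
    by (intro continuous_intros continuous_on_compose2[OF holomorphic_on_imp_continuous_on[OF hol(1)]]
          continuous_on_compose2[OF holomorphic_on_imp_continuous_on[OF hol(2)]];
        use r in \<open>auto simp: norm_mult\<close>)+
  have x: "0 \<le> x t" "x t < 1" for t
    unfolding x_def using \<phi>[of "of_real r * cis t"] r by (auto simp: norm_mult abs_square_less_1)
  have "(\<lambda>N. integral {0..2*pi} (\<lambda>t. \<Sum>n<N. (W t)\<^sup>2 * x t ^ n)) \<longlonglongrightarrow> integral {0..2*pi} (\<lambda>t. (W t)\<^sup>2 / (1 - x t))"
  proof (rule dominated_convergence)
    show "(\<lambda>t. \<Sum>n<N. (W t)\<^sup>2 * x t ^ n) integrable_on {0..2*pi}" for N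
      by (intro integrable_continuous_interval continuous_intros cont)
    show "(\<lambda>t. (W t)\<^sup>2 / (1 - x t)) integrable_on {0..2*pi}"
      by (intro integrable_continuous_interval continuous_intros cont) (metis x(2) eq_iff_diff_eq_0 less_irrefl)
    have s: "(\<lambda>n. (W t)\<^sup>2 * x t ^ n) sums ((W t)\<^sup>2 * (1 / (1 - x t)))" for t
      by (intro sums_mult geometric_sums) (use x in auto)
    show "norm (\<Sum>n<N. (W t)\<^sup>2 * x t ^ n) \<le> (W t)\<^sup>2 / (1 - x t)" for N t
    proof -
      have "(\<Sum>n<N. (W t)\<^sup>2 * x t ^ n) \<le> (\<Sum>n. (W t)\<^sup>2 * x t ^ n)"
        by (rule sum_le_suminf) (use s x in \<open>auto simp: sums_iff\<close>)
      moreover have "0 \<le> (\<Sum>n<N. (W t)\<^sup>2 * x t ^ n)"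
        using x by (intro sum_nonneg) auto
      ultimately show ?thesis using s[of t] by (simp add: sums_iff)
    qed
    show "(\<lambda>N. \<Sum>n<N. (W t)\<^sup>2 * x t ^ n) \<longlonglongrightarrow> (W t)\<^sup>2 / (1 - x t)" for t
      using s[of t] by (simp add: sums_def)
  qed
  then have "(\<lambda>N. integral {0..2*pi} (\<lambda>t. \<Sum>n<N. (W t)\<^sup>2 * x t ^ n) / (2*pi)) \<longlonglongrightarrow> ?J / (2*pi)"
    unfolding W_def x_def by (rule tendsto_divide) auto
  moreover have "integral {0..2*pi} (\<lambda>t. \<Sum>n<N. (W t)\<^sup>2 * x t ^ n) / (2*pi) \<le> ?M" for N
  proof -
    have "integral {0..2*pi} (\<lambda>t. \<Sum>n<N. (W t)\<^sup>2 * x t ^ n) = (\<Sum>n<N. integral {0..2*pi} (\<lambda>t. (W t)\<^sup>2 * x t ^ n))"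
      by (intro integral_sum integrable_continuous_interval continuous_intros cont) auto
    also have "\<dots> / (2*pi) = (\<Sum>n<N. mean_sq (\<lambda>z. w z * \<phi> z ^ n) r)"
      by (simp add: mean_sq_def W_def x_def sum_divide_distrib norm_mult norm_power power_mult_distrib
            flip: power_mult power_even_eq) (simp add: mult.commute)
    also have "\<dots> \<le> (\<Sum>n<N. (h2norm (\<lambda>z. w z * \<phi> z ^ n))\<^sup>2)"
      by (intro sum_mono mean_sq_le_h2norm h2 r)
    also have "\<dots> \<le> ?M"
      by (intro sum_le_suminf sm) auto
    finally show ?thesis .
  qed
  ultimately show ?thesis
    by (meson LIMSEQ_le_const2)
qed

lemma log_means_bounded:
  assumes w: "w holomorphic_on ball 0 1" "\<exists>z\<in>ball 0 1. w z \<noteq> 0" and hol: "\<phi> holomorphic_on ball 0 1"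
    and \<phi>: "\<And>z. cmod z < 1 \<Longrightarrow> cmod (\<phi> z) < 1"
    and h2: "\<And>n. hardy2 (\<lambda>z. w z * \<phi> z ^ n)"
    and sm: "summable (\<lambda>n. (h2norm (\<lambda>z. w z * \<phi> z ^ n))\<^sup>2)"
  obtains C where "\<And>r. 1/2 \<le> r \<Longrightarrow> r < 1 \<Longrightarrow>
     integral {0..2*pi} (\<lambda>t. ln (1 / (1 - (cmod (\<phi> (of_real r * cis t)))\<^sup>2))) \<le> C"
proof -
  obtain k v where v: "v holomorphic_on ball 0 1" "v 0 \<noteq> 0" "\<And>z. cmod z < 1 \<Longrightarrow> w z = z ^ k * v z"
    using w holomorphic_factor_power_at_0 by blast
  define M where "M = (\<Sum>n. (h2norm (\<lambda>z. w z * \<phi> z ^ n))\<^sup>2)"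
  show thesis
  proof
    fix r :: real assume r: "1/2 \<le> r" "r < 1"
    \<comment> \<open>With this u and h z = v (r z), the right side of Szego's inequality is the
      weighted mean up to the factor r^(-2k).\<close>
    define u where "u z = ln (1 / (1 - (cmod (\<phi> (of_real r * z)))\<^sup>2))" for z
    have x: "0 < 1 - (cmod (\<phi> (of_real r * z)))\<^sup>2" if "cmod z \<le> 1" for z
    proof -
      have "r * cmod z \<le> r * 1" using that r by (intro mult_left_mono) auto
      moreover have "cmod (of_real r * z) = r * cmod z" using r by (simp add: norm_mult)
      ultimately have "cmod (of_real r * z) < 1" using r by linarith
      from \<phi>[OF this] show ?thesis by (simp add: abs_square_less_1)
    qed
    have x': "1 - (cmod (\<phi> (of_real r * z)))\<^sup>2 \<noteq> 0" if "z \<in> sphere 0 1" for z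
      using x[of z] that by simp
    have cu: "continuous_on (sphere 0 1) u"
      unfolding u_def
      by (intro continuous_intros continuous_on_compose2[OF holomorphic_on_imp_continuous_on[OF hol]])
         (use x' r in \<open>auto simp: norm_mult\<close>)
    have "(\<lambda>z. v (of_real r * z)) holomorphic_on ball 0 (1/r)"
      by (intro holomorphic_on_compose_gen[of "\<lambda>z. of_real r * z", OF _ v(1), unfolded o_def] holomorphic_intros)
         (use r in \<open>auto simp: norm_mult field_simps\<close>)
    from Szego_inequality[OF this _ cu]
    have "(cmod (v 0))\<^sup>2 * exp (integral {0..2*pi} (\<lambda>t. u (cis t)) / (2*pi))
       \<le> integral {0..2*pi} (\<lambda>t. (cmod (v (of_real r * cis t)))\<^sup>2 * exp (u (cis t))) / (2*pi)"
      using r by simp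
    also have "(\<lambda>t. (cmod (v (of_real r * cis t)))\<^sup>2 * exp (u (cis t))) =
       (\<lambda>t. inverse (r ^ (2*k)) * ((cmod (w (of_real r * cis t)))\<^sup>2 / (1 - (cmod (\<phi> (of_real r * cis t)))\<^sup>2)))"
    proof
      fix t
      have "(cmod (w (of_real r * cis t)))\<^sup>2 = r ^ (2*k) * (cmod (v (of_real r * cis t)))\<^sup>2"
        using r v(3)[of "of_real r * cis t"]
        by (simp add: norm_mult norm_power power_mult_distrib power_even_eq)
      moreover have "exp (u (cis t)) = 1 / (1 - (cmod (\<phi> (of_real r * cis t)))\<^sup>2)"
        using x[of "cis t"] by (simp add: u_def)
      ultimately show "(cmod (v (of_real r * cis t)))\<^sup>2 * exp (u (cis t)) =
         inverse (r ^ (2*k)) * ((cmod (w (of_real r * cis t)))\<^sup>2 / (1 - (cmod (\<phi> (of_real r * cis t)))\<^sup>2))"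
        using r by simp
    qed
    also have "integral {0..2*pi} \<dots> / (2*pi) = inverse (r ^ (2*k)) *
        (integral {0..2*pi} (\<lambda>t. (cmod (w (of_real r * cis t)))\<^sup>2 / (1 - (cmod (\<phi> (of_real r * cis t)))\<^sup>2)) / (2*pi))"
      unfolding Henstock_Kurzweil_Integration.integral_mult_right by simp
    also have "\<dots> \<le> inverse (r ^ (2*k)) * M"
      using weighted_mean_le_sum_h2norm[OF w(1) hol \<phi> h2 sm, of r] r
      by (intro mult_left_mono) (auto simp: M_def)
    \<comment> \<open>Here \<open>1/2 \<le> r\<close> makes the bound independent of r.\<close>
    also have "\<dots> \<le> 4 ^ k * M"
    proof (rule mult_right_mono)
      have "(1/2) ^ (2*k) \<le> r ^ (2*k)" using r by (intro power_mono) auto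
      then have "inverse (r ^ (2*k)) \<le> inverse ((1/2) ^ (2*k))" using r by (intro le_imp_inverse_le) auto
      also have "\<dots> = 4 ^ k" by (simp add: power_mult power_one_over[of 4, symmetric] power2_eq_square flip: power_inverse)
      finally show "inverse (r ^ (2*k)) \<le> 4 ^ k" .
      show "0 \<le> M" unfolding M_def by (intro suminf_nonneg sm) auto
    qed
    finally have le: "exp (integral {0..2*pi} (\<lambda>t. u (cis t)) / (2*pi)) \<le> 4 ^ k * M / (cmod (v 0))\<^sup>2"
      using v(2) by (simp add: field_simps)
    moreover have "0 < 4 ^ k * M / (cmod (v 0))\<^sup>2"
      by (rule less_le_trans[OF exp_gt_zero le])
    ultimately have "integral {0..2*pi} (\<lambda>t. u (cis t)) / (2*pi) \<le> ln (4 ^ k * M / (cmod (v 0))\<^sup>2)"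
      by (simp add: ln_ge_iff)
    then show "integral {0..2*pi} (\<lambda>t. ln (1 / (1 - (cmod (\<phi> (of_real r * cis t)))\<^sup>2))) \<le>
        2 * pi * ln (4 ^ k * M / (cmod (v 0))\<^sup>2)"
      unfolding u_def by (simp add: field_simps)
  qed
qed

section \<open>Boundary values and outer functions\<close>

lemma AE_has_radial_limit:
  assumes "hardy2 f"
  shows "AE t in lborel. t \<in> {0..2*pi} \<longrightarrow> has_radial_limit f t"
proof -
  have "{t \<in> {0..2*pi}. \<not> has_radial_limit f t} \<in> null_sets lebesgue"
    using Fatou_radial_limits[OF assms] by (simp add: negligible_iff_null_sets)
  from AE_not_in[OF this] have "AE t in lebesgue. t \<in> {0..2*pi} \<longrightarrow> has_radial_limit f t"
    by eventually_elim auto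
  then show ?thesis by (simp add: AE_completion_iff)
qed

text \<open>A countable choice of radii keeps limits of Borel functions Borel. The shift by 2 starts
  the sequence at 1/2, the smallest radius for which the logarithmic means are bounded.\<close>

definition radius_seq :: "nat \<Rightarrow> real" where "radius_seq n = 1 - 1 / (real n + 2)"

lemma radius_seq_bounds: "1/2 \<le> radius_seq n" "radius_seq n < 1" "0 < radius_seq n"
  by (auto simp: radius_seq_def field_simps)

lemma radius_seq_at_left: "filterlim radius_seq (at_left 1) sequentially"
proof -
  have "radius_seq \<longlonglongrightarrow> 1"
    unfolding radius_seq_def by real_asymp
  then show ?thesis
    by (intro filterlim_at_withinI) (auto simp: radius_seq_bounds less_imp_neq)
qed

lemma radial_limit_tendsto:
  assumes "has_radial_limit f t"
  shows "(\<lambda>n. f (of_real (radius_seq n) * cis t)) \<longlonglongrightarrow> radial_limit f t"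
proof -
  obtain L where L: "((\<lambda>r::real. f (of_real r * cis t)) \<longlongrightarrow> L) (at_left 1)"
    using assms by (auto simp: has_radial_limit_def)
  then have "radial_limit f t = L"
    unfolding radial_limit_def by (intro tendsto_Lim) auto
  with filterlim_compose[OF L radius_seq_at_left] show ?thesis by simp
qed

lemma log_integrand_eq_of_tendsto:
  assumes "has_radial_limit f t"
  shows "log_integrand f t = (let L = lim (\<lambda>n. f (of_real (radius_seq n) * cis t)) in
     if cmod L < 1 then ennreal (ln (1 / (1 - cmod L))) else \<infinity>)"
  using assms limI[OF radial_limit_tendsto[OF assms]] by (simp add: log_integrand_def Let_def)

text \<open>The tangent at a to the convex function -ln (1 - x). Integrated against the Poisson
  kernel, it takes the place of Jensen's inequality.\<close>

lemma ln_inverse_tangent_le: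
  fixes a x :: real
  assumes "a < 1" "x < 1"
  shows "ln (1 / (1 - a)) + (x - a) / (1 - a) \<le> ln (1 / (1 - x))"
proof -
  have "ln ((1 - x) / (1 - a)) \<le> (1 - x) / (1 - a) - 1"
    using assms by (intro ln_le_minus_one) auto
  also have "\<dots> = - ((x - a) / (1 - a))"
    using assms by (simp add: field_simps)
  finally show ?thesis using assms by (simp add: ln_div)
qed

section \<open>Lebesgue integration of boundary functions\<close>

abbreviation circle_measure :: "real measure" where
  "circle_measure \<equiv> restrict_space lborel {0..2*pi}"

lemma finite_measure_circle: "finite_measure circle_measure"
  by (intro finite_measureI) (simp add: emeasure_restrict_space)

lemma integrable_circle_bounded:
  fixes f :: "real \<Rightarrow> 'a::{banach, second_countable_topology}"
  assumes "f \<in> borel_measurable borel" "\<And>t. norm (f t) \<le> B"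
  shows "integrable circle_measure f"
  using assms
  by (intro finite_measure.integrable_const_bound[OF finite_measure_circle, of _ B] AE_I2)
     (auto intro: measurable_restrict_space1)

lemma integral_circle_eq:
  fixes f :: "real \<Rightarrow> 'a::euclidean_space"
  assumes "continuous_on {0..2*pi} f"
  shows "integral\<^sup>L circle_measure f = integral {0..2*pi} f"
proof -
  have "integral\<^sup>L circle_measure f = (LINT t:{0..2*pi}|lborel. f t)"
    by (simp add: integral_restrict_space set_lebesgue_integral_def)
  also have "\<dots> = integral {0..2*pi} f"
    by (intro set_borel_integral_eq_integral borel_integrable_atLeastAtMost' assms)
  finally show ?thesis .
qed

lemma borel_measurable_circle_continuous:
  fixes f :: "real \<Rightarrow> 'a::topological_space"
  assumes "continuous_on UNIV f"
  shows "f \<in> borel_measurable circle_measure"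
  using assms by (intro measurable_restrict_space1) (simp add: borel_measurable_continuous_onI)

lemma borel_measurable_cis [measurable]: "cis \<in> borel_measurable borel"
  by (intro borel_measurable_continuous_onI continuous_intros)

lemma borel_measurable_poisson_kernel [measurable]: "poisson_kernel z \<in> borel_measurable borel"
  unfolding poisson_kernel_def[abs_def] by measurable

lemma norm_cis_diff_ge: "1 - cmod z \<le> cmod (cis t - z)"
  using norm_triangle_ineq2[of "cis t" z] by simp

lemma poisson_kernel_le:
  assumes "cmod z < 1"
  shows "\<bar>poisson_kernel z t\<bar> \<le> 1 / (1 - cmod z)\<^sup>2"
proof -
  have "(1 - cmod z)\<^sup>2 \<le> (cmod (cis t - z))\<^sup>2"
    using norm_cis_diff_ge assms by (intro power_mono) auto
  moreover have "(cmod z)\<^sup>2 \<le> 1" using assms by (simp add: power_le_one)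
  ultimately have "poisson_kernel z t \<le> 1 / (1 - cmod z)\<^sup>2"
    unfolding poisson_kernel_def using assms by (intro frac_le) auto
  then show ?thesis using poisson_kernel_nonneg[OF assms] by simp
qed

text \<open>With x = \<open>cis (- t) * z\<close> the kernel is (1 + x) / (1 - x) = 2 / (1 - x) - 1,
  a geometric series with the constant term corrected.\<close>

lemma herglotz_kernel_sums:
  assumes z: "cmod z < 1"
  shows "(\<lambda>n. (if n = 0 then 1 else 2) * (cis (- t) * z) ^ n) sums ((cis t + z) / (cis t - z))"
proof -
  let ?x = "cis (- t) * z"
  have x: "cmod ?x < 1" using z by (simp add: norm_mult)
  have "(\<lambda>n. 2 * ?x ^ n - (if n = 0 then 1 else 0)) sums (2 * (1 / (1 - ?x)) - 1)"
    by (intro sums_diff sums_mult geometric_sums x sums_single)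
  moreover have "2 * ?x ^ n - (if n = 0 then 1 else 0) = (if n = 0 then 1 else 2) * ?x ^ n" for n
    by simp
  moreover have "2 * (1 / (1 - ?x)) - 1 = (cis t + z) / (cis t - z)"
  proof -
    have "cis t * ?x = z" by (simp add: cis_mult flip: mult.assoc)
    then have "(cis t + z) / (cis t - z) = (cis t * (1 + ?x)) / (cis t * (1 - ?x))"
      by (simp only: distrib_left right_diff_distrib mult_1_right)
    also have "\<dots> = (1 + ?x) / (1 - ?x)" by simp
    also have "\<dots> = 2 * (1 / (1 - ?x)) - 1"
    proof -
      have "1 - ?x \<noteq> 0" using x by (metis eq_iff_diff_eq_0 less_irrefl norm_one)
      then show ?thesis by (simp add: divide_simps)
    qed
    finally show ?thesis by simp
  qed
  ultimately show ?thesis by simp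
qed

lemma Re_herglotz_kernel:
  assumes "cmod z < 1"
  shows "Re ((cis t + z) / (cis t - z)) = poisson_kernel z t"
proof -
  have "Re ((cis t + z) * cnj (cis t - z)) = 1 - (cmod z)\<^sup>2"
    unfolding cmod_power2 using sin_cos_squared_add[of t] by (simp add: algebra_simps power2_eq_square)
  then show ?thesis
    by (simp add: poisson_kernel_def Re_divide_numeral complex_div_cnj[of "cis t + z"] del: complex_cnj_diff)
qed

text \<open>Integrating the kernel series term by term gives a power series whose coefficients are
  Fourier coefficients of u, doubled for n > 0; holomorphy is then immediate. It supplies the
  exponent of the outer function.\<close>

lemma Herglotz_transform:
  fixes u :: "real \<Rightarrow> real"
  assumes u: "integrable circle_measure u"
  obtains H where "H holomorphic_on ball 0 1"
    "\<And>z. cmod z < 1 \<Longrightarrow> Re (H z) = (\<integral>t. poisson_kernel z t * u t \<partial>circle_measure) / (2*pi)"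
proof -
  let ?M = "circle_measure"
  define \<kappa> :: "nat \<Rightarrow> complex" where "\<kappa> n = (if n = 0 then 1 else 2)" for n
  define b where "b n = \<kappa> n * (\<integral>t. cis (- t) ^ n * of_real (u t) \<partial>?M) / of_real (2*pi)" for n
  define H where "H z = (\<integral>t. (cis t + z) / (cis t - z) * of_real (u t) \<partial>?M) / of_real (2*pi)" for z
  have [measurable]: "u \<in> borel_measurable ?M" using u by simp
  have meas: "(\<lambda>t. cis (- t) ^ n) \<in> borel_measurable ?M" for n
    by (intro borel_measurable_circle_continuous continuous_intros)
  have int0: "integrable ?M (\<lambda>t. cis (- t) ^ n * of_real (u t))" for n
    by (rule Bochner_Integration.integrable_bound[OF u]) (use meas in \<open>auto simp: norm_mult norm_power\<close>)
  have H: "(\<lambda>n. b n * z ^ n) sums H z"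
    and intH: "integrable ?M (\<lambda>t. (cis t + z) / (cis t - z) * of_real (u t))"
    if z: "cmod z < 1" for z
  proof -
    define f where "f n t = \<kappa> n * (cis (- t) * z) ^ n * of_real (u t)" for n t
    have f: "f n = (\<lambda>t. \<kappa> n * z ^ n * (cis (- t) ^ n * of_real (u t)))" for n
      by (auto simp: f_def power_mult_distrib)
    have intf: "integrable ?M (f n)" for n
      unfolding f by (intro integrable_mult_right int0)
    have norm: "norm (f n t) = norm (\<kappa> n) * cmod z ^ n * \<bar>u t\<bar>" for n t
      by (simp add: f_def norm_mult norm_power power_mult_distrib)
    have sm: "summable (\<lambda>n. norm (\<kappa> n) * cmod z ^ n)"
    proof (rule summable_comparison_test')
      show "summable (\<lambda>n. 2 * cmod z ^ n)" using z by (intro summable_mult summable_geometric) auto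
      show "norm (norm (\<kappa> n) * cmod z ^ n) \<le> 2 * cmod z ^ n" for n
        by (simp add: \<kappa>_def)
    qed
    have s1: "AE t in ?M. summable (\<lambda>n. norm (f n t))"
      unfolding norm by (intro AE_I2 summable_mult2 sm)
    have s2: "summable (\<lambda>n. \<integral>t. norm (f n t) \<partial>?M)"
      unfolding norm using u by (simp add: summable_mult2 sm)
    have sumf: "(\<Sum>n. f n t) = (cis t + z) / (cis t - z) * of_real (u t)" for t
      unfolding f_def \<kappa>_def by (intro sums_unique[symmetric] sums_mult2 herglotz_kernel_sums z)
    have "(\<lambda>n. integral\<^sup>L ?M (f n)) sums (\<integral>t. (cis t + z) / (cis t - z) * of_real (u t) \<partial>?M)"
      using sums_integral[OF intf s1 s2] unfolding sumf .
    from sums_divide[OF this, of "of_real (2*pi)"]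
    show "(\<lambda>n. b n * z ^ n) sums H z"
      unfolding H_def b_def f by (simp add: mult_ac)
    show "integrable ?M (\<lambda>t. (cis t + z) / (cis t - z) * of_real (u t))"
      using integrable_suminf[OF intf s1 s2] unfolding sumf .
  qed
  show thesis
  proof
    show "H holomorphic_on ball 0 1"
      by (rule power_series_holomorphic[where a = b]) (use H in auto)
    show "Re (H z) = (\<integral>t. poisson_kernel z t * u t \<partial>?M) / (2*pi)" if z: "cmod z < 1" for z
    proof -
      have "Re (\<integral>t. (cis t + z) / (cis t - z) * of_real (u t) \<partial>?M) =
          (\<integral>t. Re ((cis t + z) / (cis t - z) * of_real (u t)) \<partial>?M)"
        by (rule integral_Re[symmetric, OF intH[OF z]])
      also have "\<dots> = (\<integral>t. poisson_kernel z t * u t \<partial>?M)"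
        by (intro Bochner_Integration.integral_cong refl)
           (simp only: Re_herglotz_kernel[OF z, symmetric] Re_complex_of_real times_complex.simps
              Im_complex_of_real mult_zero_right diff_zero)
      finally show ?thesis
        unfolding H_def by (simp add: Re_divide_of_real del: of_real_mult)
    qed
  qed
qed

text \<open>The dilates by \<open>radius_seq n\<close> are holomorphic beyond the closed disc and
  obey the formula there; boundedness of f and of the kernel for fixed z allows dominated
  convergence.\<close>

lemma Poisson_formula_boundary:
  assumes hol: "f holomorphic_on ball 0 1" and B: "\<And>z. cmod z < 1 \<Longrightarrow> cmod (f z) \<le> B"
    and L: "L \<in> borel_measurable borel"
    and lim: "AE t in circle_measure. (\<lambda>n. f (of_real (radius_seq n) * cis t)) \<longlonglongrightarrow> L t"
    and z: "cmod z < 1"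
  shows "(\<integral>t. of_real (poisson_kernel z t) * L t \<partial>circle_measure) = of_real (2*pi) * f z"
proof -
  let ?M = "circle_measure"
  have r: "cmod (of_real (radius_seq n) * a) < 1" if "cmod a \<le> 1" for n a
  proof -
    have "radius_seq n * cmod a \<le> radius_seq n * 1"
      using that radius_seq_bounds(3)[of n] by (intro mult_left_mono) auto
    moreover have "cmod (of_real (radius_seq n) * a) = radius_seq n * cmod a"
      using radius_seq_bounds(3)[of n] by (simp add: norm_mult)
    ultimately show ?thesis using radius_seq_bounds(2)[of n] by linarith
  qed
  have cont: "continuous_on S (\<lambda>t. f (of_real (radius_seq n) * cis t))" for n S
    by (intro continuous_on_compose2[OF holomorphic_on_imp_continuous_on[OF hol]] continuous_intros)
       (auto intro!: r)
  have "(\<lambda>n. \<integral>t. of_real (poisson_kernel z t) * f (of_real (radius_seq n) * cis t) \<partial>?M)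
     \<longlonglongrightarrow> (\<integral>t. of_real (poisson_kernel z t) * L t \<partial>?M)"
  proof (rule integral_dominated_convergence)
    show "(\<lambda>t. of_real (poisson_kernel z t) * L t) \<in> borel_measurable ?M"
      using L by (intro measurable_restrict_space1) measurable
    show "(\<lambda>t. of_real (poisson_kernel z t) * f (of_real (radius_seq n) * cis t)) \<in> borel_measurable ?M" for n
      by (intro borel_measurable_circle_continuous continuous_intros cont
            continuous_on_poisson_kernel z)
    show "integrable ?M (\<lambda>t. 1 / (1 - cmod z)\<^sup>2 * B)"
      by (intro integrable_circle_bounded) auto
    show "AE t in ?M. (\<lambda>n. of_real (poisson_kernel z t) * f (of_real (radius_seq n) * cis t))
        \<longlonglongrightarrow> of_real (poisson_kernel z t) * L t"
      using lim by eventually_elim (intro tendsto_intros)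
    show "AE t in ?M. norm (of_real (poisson_kernel z t) * f (of_real (radius_seq n) * cis t)) \<le> 1 / (1 - cmod z)\<^sup>2 * B" for n
    proof (rule AE_I2)
      fix t
      show "norm (of_real (poisson_kernel z t) * f (of_real (radius_seq n) * cis t)) \<le> 1 / (1 - cmod z)\<^sup>2 * B"
        unfolding norm_mult norm_of_real
        by (intro mult_mono poisson_kernel_le z B r) auto
    qed
  qed
  moreover have "(\<integral>t. of_real (poisson_kernel z t) * f (of_real (radius_seq n) * cis t) \<partial>?M) =
     of_real (2*pi) * f (of_real (radius_seq n) * z)" for n
  proof -
    have "(\<lambda>z. f (of_real (radius_seq n) * z)) holomorphic_on ball 0 (1 / radius_seq n)"
      by (intro holomorphic_on_compose_gen[of "\<lambda>z. of_real (radius_seq n) * z", OF _ hol, unfolded o_def] holomorphic_intros)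
         (use radius_seq_bounds[of n] in \<open>auto simp: norm_mult field_simps\<close>)
    from Poisson_formula[OF this _ z] radius_seq_bounds[of n]
    have "integral {0..2*pi} (\<lambda>t. of_real (poisson_kernel z t) * f (of_real (radius_seq n) * cis t)) =
       of_real (2*pi) * f (of_real (radius_seq n) * z)"
      by (simp add: integral_unique)
    then show ?thesis
      by (subst integral_circle_eq)
         (intro continuous_intros cont continuous_on_poisson_kernel z, simp)
  qed
  moreover have "(\<lambda>n. of_real (2*pi) * f (of_real (radius_seq n) * z)) \<longlonglongrightarrow> of_real (2*pi) * f z"
  proof -
    have "radius_seq \<longlonglongrightarrow> 1"
      using radius_seq_at_left filterlim_at by blast
    then have "(\<lambda>n. of_real (radius_seq n) * z) \<longlonglongrightarrow> of_real 1 * z"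
      by (intro tendsto_intros)
    moreover have "isCont f z"
      using hol z holomorphic_on_imp_continuous_on continuous_on_eq_continuous_at[of "ball 0 1" f] by auto
    ultimately show ?thesis
      by (intro tendsto_intros isCont_tendsto_compose[of z f]) auto
  qed
  ultimately show ?thesis
    by (simp add: LIMSEQ_unique)
qed

text \<open>Cauchy--Schwarz between the Taylor coefficients and the powers of z; 1 / (1 - |z|^2) is
  the squared norm of the reproducing kernel at z.\<close>

lemma norm_le_h2norm:
  assumes f: "hardy2 f" and z: "cmod z < 1"
  shows "(cmod (f z))\<^sup>2 * (1 - (cmod z)\<^sup>2) \<le> (h2norm f)\<^sup>2"
proof -
  define a where "a = taylor_coeff f"
  have z2: "norm ((cmod z)\<^sup>2) < 1" using z by (simp add: abs_square_less_1)
  have "(cmod (f z))\<^sup>2 \<le> (h2norm f)\<^sup>2 * (1 / (1 - (cmod z)\<^sup>2))"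
  proof (rule LIMSEQ_le_const2)
    have "(\<lambda>n. a n * z ^ n) sums f z"
      using f z unfolding a_def hardy2_def by (intro taylor_coeff_sums) auto
    then show "(\<lambda>N. (cmod (\<Sum>n<N. a n * z ^ n))\<^sup>2) \<longlonglongrightarrow> (cmod (f z))\<^sup>2"
      unfolding sums_def by (intro tendsto_intros)
    have "(cmod (\<Sum>n<N. a n * z ^ n))\<^sup>2 \<le> (h2norm f)\<^sup>2 * (1 / (1 - (cmod z)\<^sup>2))" for N
    proof -
      have "(cmod (\<Sum>n<N. a n * z ^ n))\<^sup>2 \<le> (\<Sum>n<N. cmod (a n) * cmod z ^ n)\<^sup>2"
        by (intro power_mono order.trans[OF norm_sum]) (auto simp: norm_mult norm_power)
      also have "\<dots> \<le> (\<Sum>n<N. (cmod (a n))\<^sup>2) * (\<Sum>n<N. (cmod z ^ n)\<^sup>2)"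
        by (rule Cauchy_Schwarz_ineq_sum)
      also have "\<dots> \<le> (h2norm f)\<^sup>2 * (1 / (1 - (cmod z)\<^sup>2))"
      proof (rule mult_mono)
        show "(\<Sum>n<N. (cmod (a n))\<^sup>2) \<le> (h2norm f)\<^sup>2"
          using sum_le_suminf[OF sums_summable[OF h2norm_sums[OF f]], of "{..<N}"] sums_unique[OF h2norm_sums[OF f]]
          by (simp add: a_def)
        have g: "(\<lambda>n. ((cmod z)\<^sup>2) ^ n) sums (1 / (1 - (cmod z)\<^sup>2))"
          by (rule geometric_sums[OF z2])
        show "(\<Sum>n<N. (cmod z ^ n)\<^sup>2) \<le> 1 / (1 - (cmod z)\<^sup>2)"
          using sum_le_suminf[OF sums_summable[OF g], of "{..<N}"] sums_unique[OF g]
          by (simp flip: power_mult add: mult.commute)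
      qed (auto intro!: sum_nonneg)
      finally show ?thesis .
    qed
    then show "\<exists>N. \<forall>n\<ge>N. (cmod (\<Sum>n<n. a n * z ^ n))\<^sup>2 \<le> (h2norm f)\<^sup>2 * (1 / (1 - (cmod z)\<^sup>2))"
      by blast
  qed
  with z2 show ?thesis by (simp add: field_simps)
qed

text \<open>The weight cancels the growth of point evaluation at \<open>\<phi> z\<close>, so the
  image of f is bounded by the norm of f. For the Hilbert--Schmidt sum, (1 - x) times the partial
  geometric sum in x = |phi|^2 is 1 - x^N \<le> 1.\<close>

lemma wcomp_HS_if_bounded:
  assumes hol: "w holomorphic_on ball 0 1" "\<phi> holomorphic_on ball 0 1"
    and \<phi>: "\<And>z. cmod z < 1 \<Longrightarrow> cmod (\<phi> z) < 1"
    and w: "\<And>z. cmod z < 1 \<Longrightarrow> (cmod (w z))\<^sup>2 \<le> 1 - (cmod (\<phi> z))\<^sup>2"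
  shows "wcomp_HS w \<phi>"
proof -
  have holc: "(\<lambda>z. w z * f (\<phi> z)) holomorphic_on ball 0 1" if "hardy2 f" for f
    by (intro holomorphic_intros hol holomorphic_on_compose_gen[OF hol(2), unfolded o_def, where t = "ball 0 1"])
       (use that \<phi> in \<open>auto simp: hardy2_def\<close>)
  have bd: "cmod (w z * f (\<phi> z)) \<le> h2norm f" if f: "hardy2 f" and z: "cmod z < 1" for f z
  proof -
    have "(cmod (w z * f (\<phi> z)))\<^sup>2 \<le> (1 - (cmod (\<phi> z))\<^sup>2) * (cmod (f (\<phi> z)))\<^sup>2"
      unfolding norm_mult power_mult_distrib by (intro mult_right_mono w z) auto
    also have "\<dots> \<le> (h2norm f)\<^sup>2"
      using norm_le_h2norm[OF f \<phi>[OF z]] by (simp add: mult.commute)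
    finally show ?thesis
      by (rule power2_le_imp_le) (simp add: h2norm_def suminf_nonneg f[unfolded hardy2_def])
  qed
  have 1: "hardy2 (\<lambda>z. w z * f (\<phi> z))" "h2norm (\<lambda>z. w z * f (\<phi> z)) \<le> 1 * h2norm f" if "hardy2 f" for f
    using hardy2_bounded[OF holc[OF that] bd[OF that]] by simp_all
  have powhol: "(\<lambda>z. w z * \<phi> z ^ n) holomorphic_on ball 0 1" for n
    by (intro holomorphic_intros hol)
  have w1: "cmod (w z) \<le> 1" if "cmod z < 1" for z
    by (rule power2_le_imp_le) (use w[OF that] in \<open>auto intro: order.trans\<close>)
  have pow: "hardy2 (\<lambda>z. w z * \<phi> z ^ n)" for n
  proof (rule hardy2_bounded(1)[OF powhol])
    fix z assume z: "cmod z < 1"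
    have "cmod (w z) * cmod (\<phi> z) ^ n \<le> 1 * 1"
      using w1[OF z] \<phi>[OF z] by (intro mult_mono power_le_one) auto
    then show "cmod (w z * \<phi> z ^ n) \<le> 1" by (simp add: norm_mult norm_power)
  qed
  have "(\<Sum>n<N. (h2norm (\<lambda>z. w z * \<phi> z ^ n))\<^sup>2) \<le> 1" for N
  proof (rule sum_h2norm_le[OF pow])
    fix r :: real assume r: "0 \<le> r" "r < 1"
    have contw: "continuous_on {0..2*pi} (\<lambda>t. w (of_real r * cis t))"
      and cont\<phi>: "continuous_on {0..2*pi} (\<lambda>t. \<phi> (of_real r * cis t))"
      by (intro continuous_on_compose2[OF holomorphic_on_imp_continuous_on[OF hol(1)]]
          continuous_on_compose2[OF holomorphic_on_imp_continuous_on[OF hol(2)]] continuous_intros;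
          use r in \<open>auto simp: norm_mult\<close>)+
    have "(\<Sum>n<N. mean_sq (\<lambda>z. w z * \<phi> z ^ n) r) =
       integral {0..2*pi} (\<lambda>t. \<Sum>n<N. (cmod (w (of_real r * cis t) * \<phi> (of_real r * cis t) ^ n))\<^sup>2) / (2*pi)"
      unfolding mean_sq_def sum_divide_distrib[symmetric]
      by (subst integral_sum) (auto intro!: integrable_continuous_interval continuous_intros contw cont\<phi>)
    also have "\<dots> \<le> integral {0..2*pi} (\<lambda>t. 1) / (2*pi)"
    proof (intro divide_right_mono integral_le)
      show "(\<lambda>t. \<Sum>n<N. (cmod (w (of_real r * cis t) * \<phi> (of_real r * cis t) ^ n))\<^sup>2) integrable_on {0..2*pi}"
        by (intro integrable_continuous_interval continuous_intros contw cont\<phi>)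
      fix t
      let ?z = "of_real r * cis t" and ?x = "(cmod (\<phi> (of_real r * cis t)))\<^sup>2"
      have z: "cmod ?z < 1" using r by (simp add: norm_mult)
      have x: "?x < 1" using \<phi>[OF z] by (simp add: abs_square_less_1)
      have "(\<Sum>n<N. (cmod (w ?z * \<phi> ?z ^ n))\<^sup>2) = (cmod (w ?z))\<^sup>2 * (\<Sum>n<N. ?x ^ n)"
        by (simp add: norm_mult norm_power power_mult_distrib sum_distrib_left flip: power_mult)
           (simp add: mult.commute)
      also have "\<dots> \<le> (1 - ?x) * (\<Sum>n<N. ?x ^ n)"
        by (intro mult_right_mono w z sum_nonneg) auto
      also have "\<dots> = 1 - ?x ^ N"
        using x by (simp add: sum_gp_strict)
      also have "\<dots> \<le> 1" by simp
      finally show "(\<Sum>n<N. (cmod (w ?z * \<phi> ?z ^ n))\<^sup>2) \<le> 1" .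
    qed auto
    finally show "(\<Sum>n<N. mean_sq (\<lambda>z. w z * \<phi> z ^ n) r) \<le> 1" by simp
  qed
  then have "summable (\<lambda>n. (h2norm (\<lambda>z. w z * \<phi> z ^ n))\<^sup>2)"
    by (intro summableI_nonneg_bounded) auto
  with 1 show ?thesis unfolding wcomp_HS_def by blast
qed

section \<open>The characterization\<close>

text \<open>The term \<open>ln 2\<close> bounds ln (1 + |L|), which is lost in passing from 1 -
  |L|^2 to 1 - |L|. Where |L| = 1 the liminf is infinite, in agreement with the convention for the
  integrand.\<close>

lemma log_integrand_le_liminf:
  assumes \<phi>: "\<And>z. cmod z < 1 \<Longrightarrow> cmod (\<phi> z) < 1" and lim: "has_radial_limit \<phi> t"
  shows "log_integrand \<phi> t \<le>
    liminf (\<lambda>n. ennreal (ln (1 / (1 - (cmod (\<phi> (of_real (radius_seq n) * cis t)))\<^sup>2)))) + ennreal (ln 2)"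
proof -
  define L where "L = radial_limit \<phi> t"
  define x where "x n = cmod (\<phi> (of_real (radius_seq n) * cis t))" for n
  have "cmod (of_real (radius_seq n) * cis t) < 1" for n
    using radius_seq_bounds[of n] by (simp add: norm_mult)
  then have x: "0 \<le> x n" "x n < 1" "(x n)\<^sup>2 < 1" for n
    using \<phi> by (auto simp: x_def abs_square_less_1)
  have xL: "x \<longlonglongrightarrow> cmod L"
    unfolding x_def L_def by (intro tendsto_intros radial_limit_tendsto lim)
  have "cmod L \<le> 1"
    by (rule LIMSEQ_le_const2[OF xL]) (use x(2) less_imp_le in blast)
  then consider "cmod L < 1" | "cmod L = 1" by linarith
  then show ?thesis
  proof cases
    case 1
    have L2: "(cmod L)\<^sup>2 < 1" using 1 by (simp add: abs_square_less_1)
    have "(\<lambda>n. ennreal (ln (1 / (1 - (x n)\<^sup>2)))) \<longlonglongrightarrow> ennreal (ln (1 / (1 - (cmod L)\<^sup>2)))"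
      by (intro tendsto_intros xL) (use L2 in auto)
    then have li: "liminf (\<lambda>n. ennreal (ln (1 / (1 - (x n)\<^sup>2)))) = ennreal (ln (1 / (1 - (cmod L)\<^sup>2)))"
      by (intro lim_imp_Liminf) auto
    have fact: "1 - (cmod L)\<^sup>2 = (1 - cmod L) * (1 + cmod L)"
      by (simp add: algebra_simps power2_eq_square)
    have pos: "0 < 1 + cmod L" by (simp add: add_pos_nonneg)
    have "ln (1 / (1 - cmod L)) = ln (1 / (1 - (cmod L)\<^sup>2)) + ln (1 + cmod L)"
      unfolding fact using 1 pos by (simp add: ln_div ln_mult)
    also have "ln (1 + cmod L) \<le> ln 2"
      using 1 pos by simp
    finally have "ennreal (ln (1 / (1 - cmod L))) \<le> ennreal (ln (1 / (1 - (cmod L)\<^sup>2)) + ln 2)"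
      by (intro ennreal_leI) simp
    also have "\<dots> = ennreal (ln (1 / (1 - (cmod L)\<^sup>2))) + ennreal (ln 2)"
      using L2 by (intro ennreal_plus) (auto simp: ln_div)
    finally show ?thesis
      using lim 1 li unfolding log_integrand_def L_def[symmetric] x_def[symmetric] by simp
  next
    case 2
    have "(\<lambda>n. 1 - (x n)\<^sup>2) \<longlonglongrightarrow> 1 - (cmod L)\<^sup>2" by (intro tendsto_intros xL)
    then have "filterlim (\<lambda>n. inverse (1 - (x n)\<^sup>2)) at_top sequentially"
      using 2 x(3) by (intro filterlim_inverse_at_top) auto
    then have "filterlim (\<lambda>n. ln (1 / (1 - (x n)\<^sup>2))) at_top sequentially"
      by (intro filterlim_compose[OF ln_at_top]) (simp add: inverse_eq_divide)
    then have "(\<lambda>n. ennreal (ln (1 / (1 - (x n)\<^sup>2)))) \<longlonglongrightarrow> top"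
      by (simp add: ennreal_tendsto_top_eq_at_top)
    then have "liminf (\<lambda>n. ennreal (ln (1 / (1 - (x n)\<^sup>2)))) = top"
      by (intro lim_imp_Liminf) auto
    then show ?thesis unfolding x_def by simp
  qed
qed

lemma circle_log_integral_finite_iff:
  "circle_log_integral \<phi> < \<infinity> \<longleftrightarrow> (\<integral>\<^sup>+ t\<in>{0..2*pi}. log_integrand \<phi> t \<partial>lborel) < \<infinity>"
  unfolding circle_log_integral_def less_top[symmetric] infinity_ennreal_def
  by (simp add: ennreal_divide_eq_top_iff)

lemma circle_log_integral_finite_if_HS:
  assumes hol: "\<phi> holomorphic_on ball 0 1" and \<phi>: "\<And>z. cmod z < 1 \<Longrightarrow> cmod (\<phi> z) < 1"
    and w: "hardy2 w" "\<exists>z\<in>ball 0 1. w z \<noteq> 0" and HS: "wcomp_HS w \<phi>"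
  shows "circle_log_integral \<phi> < \<infinity>"
proof -
  have h2\<phi>: "hardy2 \<phi>"
    by (rule hardy2_bounded[OF hol]) (use \<phi> less_imp_le in blast)
  have "hardy2 (\<lambda>z. z ^ n)" for n
    by (rule hardy2_bounded[of _ 1]) (auto intro!: holomorphic_intros simp: norm_power power_le_one)
  then have h2: "hardy2 (\<lambda>z. w z * \<phi> z ^ n)" for n
    using HS unfolding wcomp_HS_def by blast
  have sm: "summable (\<lambda>n. (h2norm (\<lambda>z. w z * \<phi> z ^ n))\<^sup>2)"
    using HS unfolding wcomp_HS_def by blast
  have hw: "w holomorphic_on ball 0 1" using w by (simp add: hardy2_def)
  obtain C where C: "\<And>r. 1/2 \<le> r \<Longrightarrow> r < 1 \<Longrightarrow>
     integral {0..2*pi} (\<lambda>t. ln (1 / (1 - (cmod (\<phi> (of_real r * cis t)))\<^sup>2))) \<le> C"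
    using log_means_bounded[OF hw w(2) hol \<phi> h2 sm] by blast
  define U where "U n t = ln (1 / (1 - (cmod (\<phi> (of_real (radius_seq n) * cis t)))\<^sup>2))" for n t
  have z: "cmod (of_real (radius_seq n) * cis t) < 1" for n t
    using radius_seq_bounds[of n] by (simp add: norm_mult)
  have x: "(cmod (\<phi> (of_real (radius_seq n) * cis t)))\<^sup>2 < 1" for n t
    using \<phi>[OF z] by (simp add: abs_square_less_1)
  have x': "1 - (cmod (\<phi> (of_real (radius_seq n) * cis t)))\<^sup>2 \<noteq> 0" for n t
    using x[of n t] by simp
  have contU: "continuous_on S (U n)" for n S
    unfolding U_def
    by (intro continuous_intros continuous_on_compose2[OF holomorphic_on_imp_continuous_on[OF hol]])
       (use z x' in auto)
  have U0: "0 \<le> U n t" for n t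
    unfolding U_def using x[of n t] by (simp add: ln_div)
  have [measurable]: "U n \<in> borel_measurable borel" for n
    using contU by (rule borel_measurable_continuous_onI)
  have intU: "(\<integral>\<^sup>+ t\<in>{0..2*pi}. ennreal (U n t) \<partial>lborel) \<le> ennreal C" for n
  proof -
    have si: "set_integrable lborel {0..2*pi} (U n)"
      by (intro borel_integrable_atLeastAtMost' contU)
    have "(\<integral>\<^sup>+ t\<in>{0..2*pi}. ennreal (U n t) \<partial>lborel) =
        (\<integral>\<^sup>+ t. ennreal (indicator {0..2*pi} t *\<^sub>R U n t) \<partial>lborel)"
      by (intro nn_integral_cong) (auto split: split_indicator)
    also have "\<dots> = ennreal (\<integral>t. indicator {0..2*pi} t *\<^sub>R U n t \<partial>lborel)"
      using si U0 by (intro nn_integral_eq_integral) (auto simp: set_integrable_def)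
    also have "(\<integral>t. indicator {0..2*pi} t *\<^sub>R U n t \<partial>lborel) = integral {0..2*pi} (U n)"
      using set_borel_integral_eq_integral(2)[OF si] by (simp add: set_lebesgue_integral_def)
    also have "ennreal \<dots> \<le> ennreal C"
      using C[of "radius_seq n"] radius_seq_bounds[of n] unfolding U_def by (intro ennreal_leI) auto
    finally show ?thesis .
  qed
  have "(\<integral>\<^sup>+ t\<in>{0..2*pi}. log_integrand \<phi> t \<partial>lborel) \<le>
      (\<integral>\<^sup>+ t. liminf (\<lambda>n. ennreal (U n t) * indicator {0..2*pi} t) + ennreal (ln 2) * indicator {0..2*pi} t \<partial>lborel)"
  \<comment> \<open>Monotonicity of the nonnegative integral holds for arbitrary integrands; from
    here on only Borel functions occur, so additivity and Fatou's lemma apply.\<close>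
  proof (rule nn_integral_mono_AE)
    show "AE t in lborel. log_integrand \<phi> t * indicator {0..2*pi} t \<le>
        liminf (\<lambda>n. ennreal (U n t) * indicator {0..2*pi} t) + ennreal (ln 2) * indicator {0..2*pi} t"
      using AE_has_radial_limit[OF h2\<phi>]
    proof eventually_elim
      case (elim t)
      then show ?case
        using log_integrand_le_liminf[OF \<phi>, where t = t] unfolding U_def by (auto split: split_indicator)
    qed
  qed
  also have "\<dots> = (\<integral>\<^sup>+ t. liminf (\<lambda>n. ennreal (U n t) * indicator {0..2*pi} t) \<partial>lborel) +
      (\<integral>\<^sup>+ t. ennreal (ln 2) * indicator {0..2*pi} t \<partial>lborel)"
    by (rule nn_integral_add) auto
  also have "\<dots> \<le> ennreal C + (\<integral>\<^sup>+ t. ennreal (ln 2) * indicator {0..2*pi} t \<partial>lborel)"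
  proof (rule add_right_mono)
    have "(\<integral>\<^sup>+ t. liminf (\<lambda>n. ennreal (U n t) * indicator {0..2*pi} t) \<partial>lborel) \<le>
        liminf (\<lambda>n. \<integral>\<^sup>+ t\<in>{0..2*pi}. ennreal (U n t) \<partial>lborel)"
      by (rule nn_integral_liminf) auto
    also have "\<dots> \<le> ennreal C"
      using intU by (intro Liminf_le) auto
    finally show "(\<integral>\<^sup>+ t. liminf (\<lambda>n. ennreal (U n t) * indicator {0..2*pi} t) \<partial>lborel) \<le> ennreal C" .
  qed
  also have "\<dots> < \<infinity>"
    by (simp add: nn_integral_cmult_indicator flip: ennreal_mult)
  finally show ?thesis
    by (simp only: circle_log_integral_finite_iff)
qed

lemma bounded_weight_if_circle_log_integral_finite:
  assumes hol: "\<phi> holomorphic_on ball 0 1" and \<phi>: "\<And>z. cmod z < 1 \<Longrightarrow> cmod (\<phi> z) < 1"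
    and fin: "circle_log_integral \<phi> < \<infinity>"
  obtains w where "w holomorphic_on ball 0 1" "\<And>z. w z \<noteq> 0"
    "\<And>z. cmod z < 1 \<Longrightarrow> (cmod (w z))\<^sup>2 \<le> 1 - (cmod (\<phi> z))"
proof -
  let ?M = "circle_measure"
  \<comment> \<open>The limit is taken at every t, with an unspecified value where it fails to
    exist, which makes L Borel on the whole line.\<close>
  define L where "L t = lim (\<lambda>n. \<phi> (of_real (radius_seq n) * cis t))" for t
  \<comment> \<open>The default 0 keeps u real-valued; it is taken on a null set, because finiteness
    of the integral of G forces |L| < 1 almost everywhere.\<close>
  define u where "u t = (if cmod (L t) < 1 then ln (1 / (1 - cmod (L t))) else 0)" for t
  define G where "G t = (if cmod (L t) < 1 then ennreal (ln (1 / (1 - cmod (L t)))) else \<infinity>)" for t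
  have z: "cmod (of_real (radius_seq n) * cis t) < 1" for n t
    using radius_seq_bounds[of n] by (simp add: norm_mult)
  have h2\<phi>: "hardy2 \<phi>"
    by (rule hardy2_bounded[OF hol]) (use \<phi> less_imp_le in blast)
  have ae: "AE t in ?M. has_radial_limit \<phi> t"
    using AE_has_radial_limit[OF h2\<phi>] by (subst AE_restrict_space_iff) auto
  have L_lim: "AE t in ?M. (\<lambda>n. \<phi> (of_real (radius_seq n) * cis t)) \<longlonglongrightarrow> L t"
    using ae by eventually_elim (use radial_limit_tendsto limI L_def in metis)
  have Lm [measurable]: "L \<in> borel_measurable borel"
    unfolding L_def
    by (intro borel_measurable_lim_metric borel_measurable_continuous_onI
          continuous_on_compose2[OF holomorphic_on_imp_continuous_on[OF hol]] continuous_intros)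
       (use z in auto)
  have um: "u \<in> borel_measurable borel" and Gm: "G \<in> borel_measurable borel"
    unfolding u_def G_def by measurable
  have umM: "u \<in> borel_measurable ?M" and GmM: "G \<in> borel_measurable ?M"
    using um Gm by (intro measurable_restrict_space1; simp)+
  have "(\<integral>\<^sup>+ t. G t \<partial>?M) = (\<integral>\<^sup>+ t. log_integrand \<phi> t \<partial>?M)"
    using ae by (intro nn_integral_cong_AE, eventually_elim)
      (simp add: log_integrand_eq_of_tendsto G_def L_def Let_def)
  also have "\<dots> = (\<integral>\<^sup>+ t\<in>{0..2*pi}. log_integrand \<phi> t \<partial>lborel)"
    by (simp add: nn_integral_restrict_space)
  also have "\<dots> < \<infinity>"
    using fin by (simp only: circle_log_integral_finite_iff)
  finally have finG: "(\<integral>\<^sup>+ t. G t \<partial>?M) < \<infinity>" .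
  have L1: "AE t in ?M. cmod (L t) < 1"
  proof -
    have "AE t in ?M. G t \<noteq> \<infinity>"
      using nn_integral_noteq_infinite[OF GmM] finG by simp
    then show ?thesis by eventually_elim (simp add: G_def split: if_splits)
  qed
  have u: "integrable ?M u"
  proof (rule integrableI_nonneg[OF umM])
    show "AE t in ?M. 0 \<le> u t" by (auto simp: u_def ln_div)
    have "(\<integral>\<^sup>+ t. ennreal (u t) \<partial>?M) \<le> (\<integral>\<^sup>+ t. G t \<partial>?M)"
      by (intro nn_integral_mono) (auto simp: u_def G_def)
    with finG show "(\<integral>\<^sup>+ t. ennreal (u t) \<partial>?M) < \<infinity>" by (rule le_less_trans[rotated])
  qed
  obtain H where H: "H holomorphic_on ball 0 1"
    "\<And>z. cmod z < 1 \<Longrightarrow> Re (H z) = (\<integral>t. poisson_kernel z t * u t \<partial>?M) / (2*pi)"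
    using Herglotz_transform[OF u] by blast
  have key: "ln (1 / (1 - cmod (\<phi> z))) \<le> Re (H z)" if z: "cmod z < 1" for z
  proof -
    define a where "a = cmod (\<phi> z)"
    define P where "P = poisson_kernel z"
    have a: "0 \<le> a" "a < 1" using \<phi>[OF z] by (auto simp: a_def)
    have Pm: "P \<in> borel_measurable ?M"
      unfolding P_def by (intro measurable_restrict_space1) simp
    have P0: "0 \<le> P t" and P1: "\<bar>P t\<bar> \<le> 1 / (1 - cmod z)\<^sup>2" for t
      unfolding P_def using poisson_kernel_nonneg poisson_kernel_le z by auto
    have iP: "integrable ?M P"
      unfolding P_def by (rule integrable_circle_bounded) (use P1 P_def in auto)
    have LmM: "L \<in> borel_measurable ?M"
      by (intro measurable_restrict_space1) simp
    have iPL: "integrable ?M (\<lambda>t. P t * cmod (L t))"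
    proof (rule Bochner_Integration.integrable_bound[OF iP])
      show "AE t in ?M. norm (P t * cmod (L t)) \<le> norm (P t)"
        using L1 by eventually_elim (simp add: abs_mult mult_left_le)
    qed (use Pm LmM in simp)
    have iPu: "integrable ?M (\<lambda>t. P t * u t)"
    proof (rule Bochner_Integration.integrable_bound)
      show "integrable ?M (\<lambda>t. 1 / (1 - cmod z)\<^sup>2 * u t)"
        by (intro integrable_mult_right u)
      show "AE t in ?M. norm (P t * u t) \<le> norm (1 / (1 - cmod z)\<^sup>2 * u t)"
        unfolding norm_mult by (intro AE_I2 mult_right_mono) (use P1 in auto)
    qed (use Pm umM in simp)
    have intP: "(\<integral>t. P t \<partial>?M) = 2*pi"
    proof -
      have "((\<lambda>t. complex_of_real (P t)) has_integral of_real (2*pi)) {0..2*pi}"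
        using Poisson_formula[of "\<lambda>_. 1" 2 z] z by (simp add: P_def)
      from has_integral_linear[OF this bounded_linear_Re] have "(P has_integral 2*pi) {0..2*pi}"
        by (simp add: o_def)
      then show ?thesis
        using integral_circle_eq[OF continuous_on_poisson_kernel[OF z]] by (simp add: P_def integral_unique)
    qed
    \<comment> \<open>The modulus of the Poisson integral of L is at most the Poisson integral of
      |L|: this is the subharmonicity of |phi| up to the boundary.\<close>
    have PL: "2*pi*a \<le> (\<integral>t. P t * cmod (L t) \<partial>?M)"
    proof -
      have "2*pi*a = cmod (\<integral>t. of_real (P t) * L t \<partial>?M)"
        unfolding P_def a_def
        by (subst Poisson_formula_boundary[OF hol _ Lm L_lim z, of 1])
           (use \<phi> less_imp_le in \<open>auto simp: norm_mult\<close>)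
      also have "\<dots> \<le> (\<integral>t. cmod (of_real (P t) * L t) \<partial>?M)"
        by (rule integral_norm_bound)
      also have "\<dots> = (\<integral>t. P t * cmod (L t) \<partial>?M)"
        using P0 by (simp add: norm_mult)
      finally show ?thesis .
    qed
    \<comment> \<open>The added term is nonnegative by \<open>PL\<close> and is the Poisson integral
      of the linear part of the tangent at a, so the tangent inequality can be applied pointwise
      under the integral.\<close>
    have "2*pi*ln (1 / (1 - a)) \<le> 2*pi*ln (1 / (1 - a)) + ((\<integral>t. P t * cmod (L t) \<partial>?M) - 2*pi*a) / (1 - a)"
      using PL a by simp
    also have "\<dots> = (\<integral>t. ln (1 / (1 - a)) * P t + (P t * cmod (L t) - a * P t) / (1 - a) \<partial>?M)"
      using iP iPL intP by simp
    also have "\<dots> \<le> (\<integral>t. P t * u t \<partial>?M)"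
    proof (rule integral_mono_AE)
      show "integrable ?M (\<lambda>t. ln (1 / (1 - a)) * P t + (P t * cmod (L t) - a * P t) / (1 - a))"
        using iP iPL by auto
      show "AE t in ?M. ln (1 / (1 - a)) * P t + (P t * cmod (L t) - a * P t) / (1 - a) \<le> P t * u t"
        using L1
      proof eventually_elim
        case (elim t)
        have "P t * (ln (1 / (1 - a)) + (cmod (L t) - a) / (1 - a)) \<le> P t * u t"
          unfolding u_def using elim ln_inverse_tangent_le[OF a(2) elim] P0 by (intro mult_left_mono) auto
        also have "P t * (ln (1 / (1 - a)) + (cmod (L t) - a) / (1 - a)) =
           ln (1 / (1 - a)) * P t + (P t * cmod (L t) - a * P t) / (1 - a)"
          by (simp add: distrib_left right_diff_distrib mult.commute)
        finally show ?case .
      qed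
    qed (rule iPu)
    also have "\<dots> = 2*pi*Re (H z)"
      using H(2)[OF z] by (simp add: P_def)
    finally show ?thesis
      by (simp add: a_def)
  qed
  show thesis
  proof
    \<comment> \<open>The halved exponent makes the squared modulus exp (- Re H), the exponential of
      minus the Poisson integral of u.\<close>
    show "(\<lambda>z. exp (- H z / 2)) holomorphic_on ball 0 1"
      by (intro holomorphic_intros H) auto
    show "(cmod (exp (- H z / 2)))\<^sup>2 \<le> 1 - cmod (\<phi> z)" if z: "cmod z < 1" for z
    proof -
      have "(cmod (exp (- H z / 2)))\<^sup>2 = exp (- Re (H z))"
        by (simp add: power2_eq_square flip: exp_add)
      also have "\<dots> \<le> exp (- ln (1 / (1 - cmod (\<phi> z))))"
        using key[OF z] by simp
      also have "\<dots> = 1 - cmod (\<phi> z)"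
        using \<phi>[OF z] by (simp add: ln_div)
      finally show ?thesis .
    qed
  qed simp
qed

theorem theorem4p1:
  fixes \<phi> :: "complex \<Rightarrow> complex"
  assumes "\<phi> holomorphic_on ball 0 1"
      and "\<phi> ` ball 0 1 \<subseteq> ball 0 1"
  shows "(\<exists>w. hardy2 w \<and> (\<exists>z\<in>ball 0 1. w z \<noteq> 0) \<and> wcomp_HS w \<phi>)
         \<longleftrightarrow> circle_log_integral \<phi> < \<infinity>"
proof
  have \<phi>: "cmod (\<phi> z) < 1" if "cmod z < 1" for z
    using assms(2) that by (force simp: image_subset_iff)
  {
    assume "\<exists>w. hardy2 w \<and> (\<exists>z\<in>ball 0 1. w z \<noteq> 0) \<and> wcomp_HS w \<phi>"
    then show "circle_log_integral \<phi> < \<infinity>"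
      using circle_log_integral_finite_if_HS[OF assms(1) \<phi>] by blast
  next
    assume fin: "circle_log_integral \<phi> < \<infinity>"
    obtain w where w: "w holomorphic_on ball 0 1" "\<And>z. w z \<noteq> 0"
      "\<And>z. cmod z < 1 \<Longrightarrow> (cmod (w z))\<^sup>2 \<le> 1 - cmod (\<phi> z)"
      using bounded_weight_if_circle_log_integral_finite[OF assms(1) \<phi> fin] by blast
    have "(cmod (w z))\<^sup>2 \<le> 1 - (cmod (\<phi> z))\<^sup>2" if z: "cmod z < 1" for z
    proof -
      have "(cmod (\<phi> z))\<^sup>2 \<le> cmod (\<phi> z)"
        using \<phi>[OF z] by (simp add: power2_eq_square mult_left_le)
      with w(3)[OF z] show ?thesis by linarith
    qed
    then have "wcomp_HS w \<phi>"
      using wcomp_HS_if_bounded[OF w(1) assms(1) \<phi>] by blast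
    moreover have "hardy2 w"
    proof (rule hardy2_bounded(1)[OF w(1)])
      fix z assume z: "cmod z < 1"
      have "(cmod (w z))\<^sup>2 \<le> 1"
        using w(3)[OF z] norm_ge_zero[of "\<phi> z"] by linarith
      then show "cmod (w z) \<le> 1" by (simp add: abs_square_le_1)
    qed
    moreover have "\<exists>z\<in>ball 0 1. w z \<noteq> 0"
      using w(2) by (intro bexI[of _ 0]) auto
    ultimately show "\<exists>w. hardy2 w \<and> (\<exists>z\<in>ball 0 1. w z \<noteq> 0) \<and> wcomp_HS w \<phi>"
      by blast
  }
qed

end
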